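(* Let $C=(C,\triangle_\prec,\triangle_\succ)$ be a dendriform coalgebra. If $H^2_{\mathrm{coDend}}(C,C)=0$, then every formal one-parameter deformation of $C$ is equivalent to the trivial deformation $(\triangle'_{\prec,t}=\triangle_\prec,\ \triangle'_{\succ,t}=\triangle_\succ)$.
   Context: All vector spaces, linear maps and tensor products are over a field $\mathbb K$ of characteristic zero. A dendriform coalgebra $(C,\triangle_\prec,\triangle_\succ)$ is a vector space $C$ with linear maps $\triangle_\prec,\triangle_\succ:C\to C\otimes C$ satisfying $(\triangle_\prec\otimes\mathrm{id})\triangle_\prec=(\mathrm{id}\otimes(\triangle_\prec+\triangle_\succ))\triangle_\prec$, $(\triangle_\succ\otimes\mathrm{id})\triangle_\prec=(\mathrm{id}\otimes\triangle_\prec)\triangle_\succ$, $((\triangle_\prec+\triangle_\succ)\otimes\mathrm{id})\triangle_\succ=(\mathrm{id}\otimes\triangle_\succ)\triangle_\succ$. A formal one-parameter deformation of $C$ consists of formal power series $\triangle_{\prec,t}=\sum_{i\ge0}\triangle_{\prec,i}t^i$, $\triangle_{\succ,t}=\sum_{i\ge0}\triangle_{\succ,i}t^i$ with linear $\triangle_{\prec,i},\triangle_{\succ,i}:C\to C\otimes C$, $\triangle_{\prec,0}=\triangle_\prec$, $\triangle_{\succ,0}=\triangle_\succ$, making $C[[t]]$ a dendriform coalgebra over $\mathbb K[[t]]$; that is, for all $n\ge0$, $\sum_{i+j=n}(\triangle_{\prec,i}\otimes\mathrm{id})\triangle_{\prec,j}=\sum_{i+j=n}(\mathrm{id}\otimes(\triangle_{\prec,i}+\triangle_{\succ,i}))\triangle_{\prec,j}$,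 $\sum_{i+j=n}(\triangle_{\succ,i}\otimes\mathrm{id})\triangle_{\prec,j}=\sum_{i+j=n}(\mathrm{id}\otimes\triangle_{\prec,i})\triangle_{\succ,j}$, $\sum_{i+j=n}((\triangle_{\prec,i}+\triangle_{\succ,i})\otimes\mathrm{id})\triangle_{\succ,j}=\sum_{i+j=n}(\mathrm{id}\otimes\triangle_{\succ,i})\triangle_{\succ,j}$. Two deformations $(\triangle_{\prec,t},\triangle_{\succ,t})$, $(\triangle'_{\prec,t},\triangle'_{\succ,t})$ are equivalent if there is a formal isomorphism $\Phi_t=\sum_{i\ge0}\Phi_it^i$ with $\Phi_i:C\to C$ linear, $\Phi_0=\mathrm{id}$, such that $\triangle'_{\prec,t}\circ\Phi_t=(\Phi_t\otimes\Phi_t)\circ\triangle_{\prec,t}$ and $\triangle'_{\succ,t}\circ\Phi_t=(\Phi_t\otimes\Phi_t)\circ\triangle_{\succ,t}$ (i.e. coefficientwise in $t$). Cohomology. $C_n=\{[1],\dots,[n]\}$ and $\mathbb K[C_n]$ is the vector space with basis $C_n$. For $m,n\ge1$, $1\le i\le m$ define $R_0^{m,i,n}:C_{m+n-1}\to C_m$ by $[r]\mapsto[r]$ if $r\le i-1$, $[r]\mapsto[i]$ if $i\le r\le i+n-1$, $[r]\mapsto[r-n+1]$ if $i+n\le r\le m+n-1$; and $R_1^{m,i,n}:C_{m+n-1}\to\mathbb K[C_n]$ by $[r]\mapsto[r-i+1]$ if $i\le r\le i+n-1$ and $[r]\mapsto[1]+\cdots+[n]$ otherwise. For $\sigma\in\mathrm{Hom}(\mathbb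 K[C_n]\otimes X,Y)$ and $x\in\mathbb K[C_n]$ write $\sigma_x=\sigma(x;-):X\to Y$ (linear in $x$). Put $\triangle_{[1]}=\triangle_\prec$, $\triangle_{[2]}=\triangle_\succ$, extended linearly to $\mathbb K[C_2]$. $H^\bullet_{\mathrm{coDend}}(C,C)$ is the cohomology of $C^0=0$, $C^n_{\mathrm{coDend}}(C,C)=\mathrm{Hom}(\mathbb K[C_n]\otimes C,C^{\otimes n})$ ($n\ge1$) with, for $[r]\in C_{n+1}$, $$(\delta_c\sigma)_{[r]}=(\mathrm{id}\otimes\sigma_{R_1^{2,2,n}[r]})\circ\triangle_{R_0^{2,2,n}[r]}+\sum_{i=1}^n(-1)^i(\mathrm{id}^{\otimes(i-1)}\otimes\triangle_{R_1^{n,i,2}[r]}\otimes\mathrm{id}^{\otimes(n-i)})\circ\sigma_{R_0^{n,i,2}[r]}+(-1)^{n+1}(\sigma_{R_1^{2,1,n}[r]}\otimes\mathrm{id})\circ\triangle_{R_0^{2,1,n}[r]}.$$ *)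

theory Defs
  imports Complex_Main "HOL-Library.Function_Algebras"
begin

text \<open>
  Tensor powers over a field.  The tensor power of exponent \<open>n\<close> of a vector space \<open>C\<close> is realised
  inside the multilinear forms on \<open>n\<close>-tuples of linear functionals of \<open>C\<close>: the elementary tensor
  of \<open>[x\<^sub>1, \<dots>, x\<^sub>n]\<close> is the form sending \<open>[\<phi>\<^sub>1, \<dots>, \<phi>\<^sub>n]\<close> to \<open>\<phi>\<^sub>1 x\<^sub>1 * \<dots> * \<phi>\<^sub>n x\<^sub>n\<close>, and the
  tensor power is the linear span of the elementary tensors.  Over a field, and for a space of any
  dimension, this is a tensor power: see \<open>pure_multilinear\<close>, \<open>tensor_power_universal\<close> and
  \<open>tensor_power_unique\<close> below.
\<close>

type_synonym ('k, 'a) tensor = "('a \<Rightarrow> 'k) list \<Rightarrow> 'k"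

definition tscale :: "'k::times \<Rightarrow> ('b \<Rightarrow> 'k) \<Rightarrow> ('b \<Rightarrow> 'k)"
  where "tscale c T = (\<lambda>p. c * T p)"

lemma vector_space_tscale: "vector_space (tscale :: 'k::field \<Rightarrow> ('b \<Rightarrow> 'k) \<Rightarrow> _)"
  by unfold_locales (auto simp: tscale_def fun_eq_iff algebra_simps)

text \<open>
  \<open>(b\<^sub>1, f\<^sub>1), \<dots>, (b\<^sub>k, f\<^sub>k)\<close> stands for linear maps \<open>f\<^sub>j\<close> from \<open>C\<close> to its tensor power of exponent
  \<open>b\<^sub>j\<close>, and \<open>tmap\<close> is the tensor product \<open>f\<^sub>1 \<otimes> \<dots> \<otimes> f\<^sub>k\<close>, from the tensor power of exponent \<open>k\<close> to
  that of exponent \<open>b\<^sub>1 + \<dots> + b\<^sub>k\<close>.  As a tensor is a form on functionals, it acts by pulling the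
  functionals back: the \<open>j\<close>-th block of \<open>b\<^sub>j\<close> functionals becomes the functional
  \<open>\<lambda>x. f\<^sub>j x block\<^sub>j\<close>.  The characterisation on elementary tensors is \<open>tmap_Nil\<close>, \<open>tmap_Cons\<close>
  (with \<open>tprod\<close> the product of tensors, the first of which has exponent \<open>m\<close>).
\<close>

primrec pull :: "(nat \<times> ('a \<Rightarrow> ('k, 'a) tensor)) list \<Rightarrow> ('a \<Rightarrow> 'k) list \<Rightarrow> ('a \<Rightarrow> 'k) list"
  where
    "pull [] ps = []"
  | "pull (g # gs) ps = (\<lambda>x. snd g x (take (fst g) ps)) # pull gs (drop (fst g) ps)"

definition tmap ::
    "(nat \<times> ('a \<Rightarrow> ('k, 'a) tensor)) list \<Rightarrow> ('k::field, 'a) tensor \<Rightarrow> ('k, 'a) tensor"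
  where "tmap gs T = (\<lambda>ps. if length ps = sum_list (map fst gs) then T (pull gs ps) else 0)"

definition tprod :: "nat \<Rightarrow> ('k::field, 'a) tensor \<Rightarrow> ('k, 'a) tensor \<Rightarrow> ('k, 'a) tensor"
  where "tprod m S T = (\<lambda>ps. S (take m ps) * T (drop m ps))"

lemma tmap_linear: "Vector_Spaces.linear tscale tscale (tmap gs)"
  unfolding Vector_Spaces.linear_iff
  by (auto simp: vector_space_tscale, auto simp: tmap_def tscale_def fun_eq_iff)

locale char0_vector_space = vector_space scale
  for scale :: "'k::field_char_0 \<Rightarrow> 'a::ab_group_add \<Rightarrow> 'a"
begin

definition dual :: "('a \<Rightarrow> 'k) set"
  where "dual = {p. Vector_Spaces.linear scale (*) p}"

definition pure :: "'a list \<Rightarrow> ('k, 'a) tensor"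
  where "pure xs = (\<lambda>ps. if length ps = length xs \<and> set ps \<subseteq> dual
                         then prod_list (map2 (\<lambda>p x. p x) ps xs) else 0)"

definition tensor_power :: "nat \<Rightarrow> ('k, 'a) tensor set"
  where "tensor_power n = module.span tscale {pure xs |xs. length xs = n}"

definition Hom_pow :: "nat \<Rightarrow> ('a \<Rightarrow> ('k, 'a) tensor) set"
  where "Hom_pow n = {f. Vector_Spaces.linear scale tscale f \<and> range f \<subseteq> tensor_power n}"

text \<open>A linear endomorphism of \<open>C\<close>, seen as a map to the tensor power of exponent one, in the
  form in which \<open>tmap\<close> takes its factors.\<close>

definition emb :: "('a \<Rightarrow> 'a) \<Rightarrow> nat \<times> ('a \<Rightarrow> ('k, 'a) tensor)"
  where "emb f = (1, \<lambda>x. pure [f x])"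

subsection \<open>Universal property of the tensor powers\<close>

lemma dual_iff: "p \<in> dual \<longleftrightarrow> (\<forall>x y. p (x + y) = p x + p y) \<and> (\<forall>c x. p (scale c x) = c * p x)"
proof -
  have "vector_space ((*) :: 'k \<Rightarrow> 'k \<Rightarrow> 'k)"
    by unfold_locales (auto simp: algebra_simps)
  then show ?thesis
    by (auto simp: dual_def Vector_Spaces.linear_iff vector_space_axioms)
qed

lemma pure_Nil: "pure [] ps = (if ps = [] then 1 else 0)"
  by (auto simp: pure_def)

lemma pure_Cons: "pure (x # xs) ps =
    (case ps of [] \<Rightarrow> 0 | p # qs \<Rightarrow> if p \<in> dual then p x * pure xs qs else 0)"
  by (auto simp: pure_def split: list.splits)

lemma pure_append: "pure (xs @ ys) = tprod (length xs) (pure xs) (pure ys)"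
proof
  fix ps show "pure (xs @ ys) ps = tprod (length xs) (pure xs) (pure ys) ps"
  proof (induction xs arbitrary: ps)
    case Nil
    then show ?case by (simp add: pure_Nil tprod_def)
  next
    case (Cons x xs)
    then show ?case by (cases ps) (auto simp: pure_Cons tprod_def)
  qed
qed

definition multilinear ::
    "nat \<Rightarrow> ('k \<Rightarrow> 'w \<Rightarrow> 'w) \<Rightarrow> ('a list \<Rightarrow> 'w::ab_group_add) \<Rightarrow> bool"
  where "multilinear n sW h \<longleftrightarrow> (\<forall>us vs x y c. length us + length vs + 1 = n \<longrightarrow>
           h (us @ (x + y) # vs) = h (us @ x # vs) + h (us @ y # vs) \<and>
           h (us @ scale c x # vs) = sW c (h (us @ x # vs)))"

lemma pure_multilinear: "multilinear n tscale pure"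
proof -
  have "pure (us @ (x + y) # vs) ps = pure (us @ x # vs) ps + pure (us @ y # vs) ps \<and>
        pure (us @ scale c x # vs) ps = c * pure (us @ x # vs) ps" for us vs x y c ps
  proof (induction us arbitrary: ps)
    case Nil
    then show ?case by (auto simp: pure_Cons dual_iff algebra_simps split: list.splits)
  next
    case (Cons u us)
    then show ?case by (auto simp: pure_Cons algebra_simps split: list.splits)
  qed
  then show ?thesis by (auto simp: multilinear_def tscale_def fun_eq_iff)
qed

lemma multilinear_eqI:
  assumes W: "vector_space sW" and g: "multilinear n sW g" and h: "multilinear n sW h"
    and B: "span B = UNIV" and eq: "\<And>bs. set bs \<subseteq> B \<Longrightarrow> length bs = n \<Longrightarrow> g bs = h bs"
    and len: "length xs = n"
  shows "g xs = h xs"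
proof -
  interpret W: vector_space sW by (rule W)
  have "set bs \<subseteq> B \<Longrightarrow> length us + length bs = n \<Longrightarrow> g (us @ bs) = h (us @ bs)" for us bs
  proof (induction us arbitrary: bs rule: rev_induct)
    case Nil
    then show ?case by (simp add: eq)
  next
    case (snoc x us)
    have G: "g (us @ (a + b) # bs) = g (us @ a # bs) + g (us @ b # bs)"
      "h (us @ (a + b) # bs) = h (us @ a # bs) + h (us @ b # bs)"
      "g (us @ scale c a # bs) = sW c (g (us @ a # bs))"
      "h (us @ scale c a # bs) = sW c (h (us @ a # bs))" for a b c
      using g h snoc.prems by (auto simp: multilinear_def)
    have "x \<in> span B" using B by simp
    then have "g (us @ x # bs) = h (us @ x # bs)"
    proof (induction rule: span_induct_alt)
      case base
      show ?case using G(3,4)[of 0 0] by simp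
    next
      case (step c b y)
      then show ?case using snoc.IH[of "b # bs"] snoc.prems by (simp add: G)
    qed
    then show ?case by simp
  qed
  from this[of "[]" xs] this[of xs "[]"] len show ?thesis by simp
qed

theorem tensor_power_universal:
  assumes W: "vector_space sW" and h: "multilinear n sW h"
  shows "\<exists>L. Vector_Spaces.linear tscale sW L \<and> (\<forall>xs. length xs = n \<longrightarrow> L (pure xs) = h xs)"
proof -
  interpret W: vector_space sW by (rule W)
  interpret T: vector_space "tscale :: 'k \<Rightarrow> (('a \<Rightarrow> 'k) list \<Rightarrow> 'k) \<Rightarrow> _" by (rule vector_space_tscale)
  interpret TW: vector_space_pair "tscale :: 'k \<Rightarrow> (('a \<Rightarrow> 'k) list \<Rightarrow> 'k) \<Rightarrow> _" sW ..
  obtain B where B: "independent B" "span B = UNIV"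
    using basis_exists[of UNIV] by (metis top.extremum_uniqueI)
  define co where "co b = (\<lambda>x. representation B x b)" for b
  have co_dual: "co b \<in> dual" for b
    using B by (auto simp: dual_iff co_def representation_add representation_scale)
  have co_basis: "co b c = (if c = b then 1 else 0)" if "c \<in> B" for b c
    using B that by (simp add: co_def representation_basis)
  have ev: "pure cs (map co bs) = (if cs = bs then 1 else 0)"
    if "set cs \<subseteq> B" for cs bs
    using that
  proof (induction cs arbitrary: bs)
    case Nil
    then show ?case by (auto simp: pure_Nil)
  next
    case (Cons c cs)
    then show ?case by (cases bs) (auto simp: pure_Cons co_dual co_basis)
  qed
  let ?I = "{bs. set bs \<subseteq> B \<and> length bs = n}"
  have inj: "inj_on pure ?I"
    by (rule inj_onI) (metis (mono_tags, lifting) ev mem_Collect_eq zero_neq_one)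
  have "T.independent (pure ` ?I)"
    unfolding T.independent_explicit_finite_subsets
  proof (intro allI impI ballI)
    fix A u T0 assume A: "A \<subseteq> pure ` ?I" "finite A" "(\<Sum>v\<in>A. tscale (u v) v) = 0" and v: "T0 \<in> A"
    then obtain bs where bs: "T0 = pure bs" "set bs \<subseteq> B" by auto
    have "0 = (\<Sum>v\<in>A. tscale (u v) v) (map co bs)" using A by simp
    also have "\<dots> = (\<Sum>v\<in>A. u v * v (map co bs))"
      using A(2) by (induction A) (auto simp: tscale_def)
    also have "\<dots> = (\<Sum>v\<in>A. if v = T0 then u v else 0)"
    proof (rule sum.cong[OF refl])
      fix w assume "w \<in> A"
      then obtain cs where "w = pure cs" "cs \<in> ?I" using A(1) by auto
      moreover have "pure cs = pure bs \<longleftrightarrow> cs = bs" if "cs \<in> ?I" for cs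
        using bs(2) that ev[of cs bs] ev[of bs bs]
        by (metis (mono_tags, lifting) mem_Collect_eq zero_neq_one)
      ultimately show "u w * w (map co bs) = (if w = T0 then u w else 0)"
        using ev[of cs bs] bs by auto
    qed
    also have "\<dots> = u T0" using A(2) v by (simp add: sum.delta)
    finally show "u T0 = 0" by simp
  qed
  from TW.linear_independent_extend[OF this, of "h \<circ> inv_into ?I pure"]
  obtain L where L: "Vector_Spaces.linear tscale sW L"
    and Lb: "\<And>bs. bs \<in> ?I \<Longrightarrow> L (pure bs) = h bs"
    using inj by fastforce
  have "multilinear n sW (\<lambda>xs. L (pure xs))"
    using pure_multilinear[of n] L by (auto simp: multilinear_def Vector_Spaces.linear_iff)
  then have "L (pure xs) = h xs" if "length xs = n" for xs
    using multilinear_eqI[OF W _ h B(2), of "\<lambda>xs. L (pure xs)"] Lb that by auto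
  with L show ?thesis by blast
qed

theorem tensor_power_unique:
  assumes "Vector_Spaces.linear tscale sW L" "Vector_Spaces.linear tscale sW M"
    and "\<And>xs. length xs = n \<Longrightarrow> L (pure xs) = M (pure xs)" and "T \<in> tensor_power n"
  shows "L T = M T"
proof -
  interpret TW: vector_space_pair "tscale :: 'k \<Rightarrow> (('a \<Rightarrow> 'k) list \<Rightarrow> 'k) \<Rightarrow> _" sW
    using assms(1) by (simp add: vector_space_pair_def Vector_Spaces.linear_iff)
  show ?thesis
    by (rule TW.linear_eq_on_span[OF assms(1,2) _ assms(4)[unfolded tensor_power_def]])
       (use assms(3) in auto)
qed

subsection \<open>Tensor products of maps on elementary tensors\<close>

lemma tensor_power_length:
  assumes "T \<in> tensor_power n" and "length ps \<noteq> n"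
  shows "T ps = 0"
proof -
  interpret T: vector_space "tscale :: 'k \<Rightarrow> (('a \<Rightarrow> 'k) list \<Rightarrow> 'k) \<Rightarrow> _" by (rule vector_space_tscale)
  show ?thesis
    using assms(1)[unfolded tensor_power_def]
    by (induction rule: T.span_induct_alt) (use assms(2) in \<open>auto simp: tscale_def pure_def\<close>)
qed

lemma tmap_Nil: "tmap [] (pure []) = pure []"
  by (auto simp: tmap_def pure_Nil fun_eq_iff)

lemma tmap_Cons:
  assumes "f \<in> Hom_pow b"
  shows "tmap ((b, f) # gs) (pure (x # xs)) = tprod b (f x) (tmap gs (pure xs))"
proof
  fix ps
  have f: "Vector_Spaces.linear scale tscale f" "f x \<in> tensor_power b"
    using assms by (auto simp: Hom_pow_def)
  have d: "(\<lambda>x. f x (take b ps)) \<in> dual"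
    using f(1) by (auto simp: dual_iff Vector_Spaces.linear_iff tscale_def)
  show "tmap ((b, f) # gs) (pure (x # xs)) ps = tprod b (f x) (tmap gs (pure xs)) ps"
  proof (cases "length ps < b")
    case True
    then show ?thesis
      using tensor_power_length[OF f(2), of "take b ps"] by (simp add: tmap_def tprod_def)
  next
    case False
    then show ?thesis using d by (auto simp: tmap_def tprod_def pure_Cons)
  qed
qed

lemma tprod_tensor_power:
  assumes S: "S \<in> tensor_power m" and T: "T \<in> tensor_power n"
  shows "tprod m S T \<in> tensor_power (m + n)"
proof -
  interpret T: vector_space "tscale :: 'k \<Rightarrow> (('a \<Rightarrow> 'k) list \<Rightarrow> 'k) \<Rightarrow> _" by (rule vector_space_tscale)
  have bil: "tprod m (tscale c a + b) T = tscale c (tprod m a T) + tprod m b T"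
    "tprod m S (tscale c a + b) = tscale c (tprod m S a) + tprod m S b"
    "tprod m 0 T = 0" "tprod m S 0 = 0" for S T a b :: "('k, 'a) tensor" and c
    by (auto simp: tprod_def tscale_def fun_eq_iff algebra_simps)
  have pure_left: "tprod m (pure us) T \<in> tensor_power (m + n)" if "length us = m" for us
    using T[unfolded tensor_power_def]
  proof (induction rule: T.span_induct_alt)
    case base
    show ?case unfolding zero_fun_def[symmetric] bil tensor_power_def by (rule T.span_zero)
  next
    case (step c a b)
    then obtain vs where "a = pure vs" "length vs = n" by auto
    then have "tprod m (pure us) a \<in> tensor_power (m + n)"
      unfolding tensor_power_def
      by (intro T.span_base CollectI exI[of _ "us @ vs"]) (simp add: that pure_append)
    with step have "tprod m (pure us) (tscale c a + b) \<in> tensor_power (m + n)"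
      unfolding bil tensor_power_def by (intro T.span_add T.span_scale)
    then show ?case by (simp only: plus_fun_def)
  qed
  show ?thesis
    using S[unfolded tensor_power_def]
  proof (induction rule: T.span_induct_alt)
    case base
    show ?case unfolding zero_fun_def[symmetric] bil tensor_power_def by (rule T.span_zero)
  next
    case (step c a b)
    then obtain us where "a = pure us" "length us = m" by auto
    then have "tprod m a T \<in> tensor_power (m + n)" using pure_left by simp
    with step have "tprod m (tscale c a + b) T \<in> tensor_power (m + n)"
      unfolding bil tensor_power_def by (intro T.span_add T.span_scale)
    then show ?case by (simp only: plus_fun_def)
  qed
qed

lemma tmap_tensor_power:
  assumes gs: "\<And>g. g \<in> set gs \<Longrightarrow> snd g \<in> Hom_pow (fst g)" and T: "T \<in> tensor_power (length gs)"
  shows "tmap gs T \<in> tensor_power (sum_list (map fst gs))"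
proof -
  interpret T: vector_space "tscale :: 'k \<Rightarrow> (('a \<Rightarrow> 'k) list \<Rightarrow> 'k) \<Rightarrow> _" by (rule vector_space_tscale)
  have pure: "tmap gs (pure xs) \<in> tensor_power (sum_list (map fst gs))"
    if "length xs = length gs" for xs
    using that gs
  proof (induction gs arbitrary: xs)
    case Nil
    then show ?case by (auto simp: tmap_Nil tensor_power_def intro!: T.span_base)
  next
    case (Cons g gs)
    obtain b f where g: "g = (b, f)" by fastforce
    obtain y ys where "xs = y # ys" "length ys = length gs" using Cons.prems by (cases xs) auto
    moreover have "f \<in> Hom_pow b" using Cons.prems(2)[of g] g by simp
    moreover have "f y \<in> tensor_power b" using calculation by (auto simp: Hom_pow_def)
    ultimately show ?case using Cons g by (simp add: tmap_Cons tprod_tensor_power)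
  qed
  have lin: "tmap gs (tscale c a + b) = tscale c (tmap gs a) + tmap gs b" "tmap gs 0 = 0" for c a b
    by (auto simp: tmap_def tscale_def fun_eq_iff)
  show ?thesis
    using T[unfolded tensor_power_def]
  proof (induction rule: T.span_induct_alt)
    case base
    show ?case unfolding zero_fun_def[symmetric] lin tensor_power_def by (rule T.span_zero)
  next
    case (step c a b)
    then have "tmap gs a \<in> tensor_power (sum_list (map fst gs))" using pure by auto
    with step have "tmap gs (tscale c a + b) \<in> tensor_power (sum_list (map fst gs))"
      unfolding lin tensor_power_def by (intro T.span_add T.span_scale)
    then show ?case by (simp only: plus_fun_def)
  qed
qed

end

subsection \<open>Dendriform coalgebras, their cohomology and their deformations\<close>

text \<open>\<open>[r]\<close> is the number \<open>r\<close>, and \<open>C\<^sub>n = {1..n}\<close>.  A vector of the space with basis \<open>C\<^sub>n\<close> is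
  given by its coordinates, a function on \<open>nat\<close> read on \<open>{1..n}\<close>.\<close>

definition R0 :: "nat \<Rightarrow> nat \<Rightarrow> nat \<Rightarrow> nat \<Rightarrow> nat"
  where "R0 m i n r = (if r \<le> i - 1 then r else if r \<le> i + n - 1 then i else r - n + 1)"

definition R1 :: "nat \<Rightarrow> nat \<Rightarrow> nat \<Rightarrow> nat \<Rightarrow> nat \<Rightarrow> 'k::field"
  where "R1 m i n r = (if i \<le> r \<and> r \<le> i + n - 1
                       then (\<lambda>s. if s = r - i + 1 then 1 else 0)
                       else (\<lambda>s. if s \<in> {1..n} then 1 else 0))"

text \<open>\<open>\<sigma> \<in> Hom(K[C\<^sub>n] \<otimes> C, Y)\<close> is given by the linear maps \<open>\<sigma> r = \<sigma>\<^bsub>[r]\<^esub>\<close> for \<open>r \<in> {1..n}\<close>;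
  \<open>at_vec n \<sigma> v\<close> is \<open>\<sigma>\<^bsub>v\<^esub>\<close> for a vector \<open>v\<close>.\<close>

definition at_vec ::
    "nat \<Rightarrow> (nat \<Rightarrow> 'a \<Rightarrow> ('k::field, 'a) tensor) \<Rightarrow> (nat \<Rightarrow> 'k) \<Rightarrow> 'a \<Rightarrow> ('k, 'a) tensor"
  where "at_vec n \<sigma> v = (\<lambda>x. \<Sum>s=1..n. tscale (v s) (\<sigma> s x))"

locale dendriform_coalgebra = char0_vector_space scale
  for scale :: "'k::field_char_0 \<Rightarrow> 'a::ab_group_add \<Rightarrow> 'a" +
  fixes dl dr :: "'a \<Rightarrow> ('k, 'a) tensor"
  assumes dl: "dl \<in> Hom_pow 2" and dr: "dr \<in> Hom_pow 2"
    and coassoc1: "tmap [(2, dl), emb id] \<circ> dl = tmap [emb id, (2, dl + dr)] \<circ> dl"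
    and coassoc2: "tmap [(2, dr), emb id] \<circ> dl = tmap [emb id, (2, dl)] \<circ> dr"
    and coassoc3: "tmap [(2, dl + dr), emb id] \<circ> dr = tmap [emb id, (2, dr)] \<circ> dr"
begin

definition \<Delta> :: "nat \<Rightarrow> 'a \<Rightarrow> ('k, 'a) tensor"
  where "\<Delta> s = (if s = 1 then dl else if s = 2 then dr else 0)"

text \<open>The value \<open>0\<close> outside \<open>{1..n}\<close> makes the family of a cochain unique; in particular the only
  cochain of degree \<open>0\<close> is \<open>0\<close>.\<close>

definition cochains :: "nat \<Rightarrow> (nat \<Rightarrow> 'a \<Rightarrow> ('k, 'a) tensor) set"
  where "cochains n = {\<sigma>. (\<forall>r\<in>{1..n}. \<sigma> r \<in> Hom_pow n) \<and> (\<forall>r. r \<notin> {1..n} \<longrightarrow> \<sigma> r = 0)}"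

definition \<delta> ::
    "nat \<Rightarrow> (nat \<Rightarrow> 'a \<Rightarrow> ('k, 'a) tensor) \<Rightarrow> nat \<Rightarrow> 'a \<Rightarrow> ('k, 'a) tensor"
  where "\<delta> n \<sigma> r = (if r \<notin> {1..n + 1} then 0 else (\<lambda>x.
      tmap [emb id, (n, at_vec n \<sigma> (R1 2 2 n r))] (\<Delta> (R0 2 2 n r) x)
    + (\<Sum>i=1..n. tscale ((-1) ^ i)
        (tmap (replicate (i - 1) (emb id) @ [(2, at_vec 2 \<Delta> (R1 n i 2 r))]
               @ replicate (n - i) (emb id)) (\<sigma> (R0 n i 2 r) x)))
    + tscale ((-1) ^ (n + 1))
        (tmap [(n, at_vec n \<sigma> (R1 2 1 n r)), emb id] (\<Delta> (R0 2 1 n r) x))))"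

definition cocycles :: "nat \<Rightarrow> (nat \<Rightarrow> 'a \<Rightarrow> ('k, 'a) tensor) set"
  where "cocycles n = {\<sigma> \<in> cochains n. \<delta> n \<sigma> = 0}"

definition coboundaries :: "nat \<Rightarrow> (nat \<Rightarrow> 'a \<Rightarrow> ('k, 'a) tensor) set"
  where "coboundaries n = (case n of 0 \<Rightarrow> {0} | Suc m \<Rightarrow> \<delta> m ` cochains m)"

text \<open>The quotient of the cocycles by the coboundaries, as a set of cosets; its zero is the coset
  \<open>coboundaries n\<close>.\<close>

definition cohomology :: "nat \<Rightarrow> (nat \<Rightarrow> 'a \<Rightarrow> ('k, 'a) tensor) set set"
  where "cohomology n =
    cocycles n // {(\<sigma>, \<tau>). \<sigma> \<in> cocycles n \<and> \<tau> \<in> cocycles n \<and> \<sigma> - \<tau> \<in> coboundaries n}"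

definition deformation ::
    "(nat \<Rightarrow> 'a \<Rightarrow> ('k, 'a) tensor) \<Rightarrow> (nat \<Rightarrow> 'a \<Rightarrow> ('k, 'a) tensor) \<Rightarrow> bool"
  where "deformation L R \<longleftrightarrow>
    (\<forall>i. L i \<in> Hom_pow 2 \<and> R i \<in> Hom_pow 2) \<and> L 0 = dl \<and> R 0 = dr \<and>
    (\<forall>n.
      (\<Sum>(i, j)\<in>{(i, j). i + j = n}. tmap [(2, L i), emb id] \<circ> L j) =
      (\<Sum>(i, j)\<in>{(i, j). i + j = n}. tmap [emb id, (2, L i + R i)] \<circ> L j) \<and>
      (\<Sum>(i, j)\<in>{(i, j). i + j = n}. tmap [(2, R i), emb id] \<circ> L j) =
      (\<Sum>(i, j)\<in>{(i, j). i + j = n}. tmap [emb id, (2, L i)] \<circ> R j) \<and>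
      (\<Sum>(i, j)\<in>{(i, j). i + j = n}. tmap [(2, L i + R i), emb id] \<circ> R j) =
      (\<Sum>(i, j)\<in>{(i, j). i + j = n}. tmap [emb id, (2, R i)] \<circ> R j))"

definition equivalent ::
    "(nat \<Rightarrow> 'a \<Rightarrow> ('k, 'a) tensor) \<Rightarrow> (nat \<Rightarrow> 'a \<Rightarrow> ('k, 'a) tensor) \<Rightarrow>
     (nat \<Rightarrow> 'a \<Rightarrow> ('k, 'a) tensor) \<Rightarrow> (nat \<Rightarrow> 'a \<Rightarrow> ('k, 'a) tensor) \<Rightarrow> bool"
  where "equivalent L R L' R' \<longleftrightarrow> (\<exists>\<Phi>.
    (\<forall>i. Vector_Spaces.linear scale scale (\<Phi> i)) \<and> \<Phi> 0 = id \<and>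
    (\<forall>n.
      (\<Sum>(i, j)\<in>{(i, j). i + j = n}. L' i \<circ> \<Phi> j) =
      (\<Sum>(i, j, k)\<in>{(i, j, k). i + j + k = n}. tmap [emb (\<Phi> i), emb (\<Phi> j)] \<circ> L k) \<and>
      (\<Sum>(i, j)\<in>{(i, j). i + j = n}. R' i \<circ> \<Phi> j) =
      (\<Sum>(i, j, k)\<in>{(i, j, k). i + j + k = n}. tmap [emb (\<Phi> i), emb (\<Phi> j)] \<circ> R k)))"

end

text \<open>A map regarded as a constant power series.\<close>

definition constant_series :: "('a \<Rightarrow> ('k::field, 'a) tensor) \<Rightarrow> nat \<Rightarrow> 'a \<Rightarrow> ('k, 'a) tensor"
  where "constant_series d = (\<lambda>i. if i = 0 then d else 0)"

end

theory Submission
  imports Defs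
begin

text \<open>
  The equivalence with the trivial deformation is solved for directly, coefficient by coefficient.
  Write \<open>\<Phi>\<^sub>t = \<Sum> \<Phi>\<^sub>i t\<^sup>i\<close> for the unknown isomorphism, with \<open>\<Phi>\<^sub>0 = id\<close>.  For a series \<open>X\<^sub>t\<close> of maps
  \<open>C \<rightarrow> C \<otimes> C\<close>, let \<open>transport \<Phi> X\<close> be the series \<open>(\<Phi>\<^sub>t \<otimes> \<Phi>\<^sub>t) X\<^sub>t\<close>; the equations to solve are
  \<open>transport \<Phi> L = dl \<Phi>\<^sub>t\<close> and \<open>transport \<Phi> R = dr \<Phi>\<^sub>t\<close>.

  Suppose they hold below degree \<open>n > 0\<close>, and take \<open>\<Phi>\<^sub>n = 0\<close> for the moment.  Let \<open>A\<close> and \<open>B\<close> be the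
  coefficients of degree \<open>n\<close> of the two left-hand sides: they are what remains to be corrected.  Apply
  \<open>\<Phi>\<^sub>t \<otimes> \<Phi>\<^sub>t \<otimes> \<Phi>\<^sub>t\<close> to the three axioms of the deformation.  In
  \<open>(\<Phi>\<^sub>t \<otimes> \<Phi>\<^sub>t \<otimes> \<Phi>\<^sub>t) (X\<^sub>t \<otimes> id) Y\<^sub>t\<close> one may replace \<open>(\<Phi>\<^sub>t \<otimes> \<Phi>\<^sub>t) X\<^sub>t\<close> by \<open>X\<^sub>0 \<Phi>\<^sub>t\<close> up to its defect
  of degree \<open>n\<close>, and then \<open>(\<Phi>\<^sub>t \<otimes> \<Phi>\<^sub>t) Y\<^sub>t\<close> appears; the coefficient of degree \<open>n\<close> is therefore
  \<open>(A\<^sub>X \<otimes> id) Y\<^sub>0 + (X\<^sub>0 \<otimes> id) A\<^sub>Y\<close>, where \<open>A\<^sub>X\<close>, \<open>A\<^sub>Y\<close> are the coefficients of degree \<open>n\<close> of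
  the transported series (\<open>transport3_left_conv\<close>, and \<open>transport3_right_conv\<close> for the other side).
  The axioms thus become the linearised axioms for \<open>(A, B)\<close>, and these say that \<open>(A, B)\<close> is a
  2-cocycle (\<open>obstruction_is_cocycle\<close>).

  As the second cohomology vanishes, \<open>(A, B)\<close> is the coboundary of a linear map \<open>\<phi>\<close>.  Changing
  \<open>\<Phi>\<^sub>n\<close> from \<open>0\<close> to \<open>- \<phi>\<close> changes \<open>transport \<Phi> X\<close> in degree \<open>n\<close> by
  \<open>- (\<phi> \<otimes> id) X\<^sub>0 - (id \<otimes> \<phi>) X\<^sub>0\<close>, which is exactly what makes the equations hold in degree \<open>n\<close>
  (\<open>extend_isomorphism\<close>).  Dependent choice over the degree gives all the \<open>\<Phi>\<^sub>n\<close>; no inverse of a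
  series and no infinite composition of isomorphisms is formed.
\<close>

section \<open>Sums over compositions of an integer\<close>

lemma sum_fun_apply: "(\<Sum>i\<in>I. f i) x = (\<Sum>i\<in>I. f i x)"
  by (induction I rule: infinite_finite_induct) auto

lemma finite_compositions2 [simp]: "finite {(i, j). i + j = (n :: nat)}"
  by (rule finite_subset[of _ "{..n} \<times> {..n}"]) auto

lemma finite_compositions3 [simp]: "finite {(i, j, k). i + j + k = (n :: nat)}"
  by (rule finite_subset[of _ "{..n} \<times> {..n} \<times> {..n}"]) auto

lemma finite_compositions4 [simp]: "finite {(i, j, k, l). i + j + k + l = (n :: nat)}"
  by (rule finite_subset[of _ "{..n} \<times> {..n} \<times> {..n} \<times> {..n}"]) auto

text \<open>
  The two ways in which a fivefold convolution is read: applying three factors to a convolution, or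
  convolving after two of the factors have been absorbed into the inner series.  Here they are absorbed
  on the left, \<open>regroup_right\<close> absorbs them on the right.
\<close>

lemma regroup_left:
  "(\<Sum>(a, b, c, m)\<in>{(a, b, c, m). a + b + c + m = n}. \<Sum>(i, j)\<in>{(i, j). i + j = m}. G a b c i j) =
   (\<Sum>(m, c, j)\<in>{(m, c, j). m + c + j = n}. \<Sum>(a, b, i)\<in>{(a, b, i). a + b + i = m}. G a b c i j)"
  for n :: nat
  by (simp add: case_prod_beta sum.Sigma)
    (rule sum.reindex_bij_witness[where
        j = "\<lambda>((a, b, c, m), (i, j)). ((a + b + i, c, j), (a, b, i))" and
        i = "\<lambda>((m, c, j), (a, b, i)). ((a, b, c, i + j), (i, j))"], auto)

lemma regroup_right:
  "(\<Sum>(a, b, c, m)\<in>{(a, b, c, m). a + b + c + m = n}. \<Sum>(i, j)\<in>{(i, j). i + j = m}. G a b c i j) =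
   (\<Sum>(a, m, j)\<in>{(a, m, j). a + m + j = n}. \<Sum>(b, c, i)\<in>{(b, c, i). b + c + i = m}. G a b c i j)"
  for n :: nat
  by (simp add: case_prod_beta sum.Sigma)
    (rule sum.reindex_bij_witness[where
        j = "\<lambda>((a, b, c, m), (i, j)). ((a, b + c + i, j), (b, c, i))" and
        i = "\<lambda>((a, m, j), (b, c, i)). ((a, b, c, i + j), (i, j))"], auto)

section \<open>Linear maps into tensor powers\<close>

lemma pull_append:
  "pull (gs @ hs) ps = pull gs ps @ pull hs (drop (sum_list (map fst gs)) ps)"
  by (induction gs arbitrary: ps) (auto simp: add.commute)

lemma tmap_add: "tmap gs (S + T) = tmap gs S + tmap gs T"
  by (auto simp: tmap_def fun_eq_iff)

lemma tmap_zero: "tmap gs 0 = 0"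
  by (auto simp: tmap_def fun_eq_iff)

lemma tmap_sum: "tmap gs (\<Sum>i\<in>I. T i) = (\<Sum>i\<in>I. tmap gs (T i))"
  by (induction I rule: infinite_finite_induct)
    (simp_all only: sum.infinite sum.empty sum.insert tmap_add tmap_zero not_False_eq_True)

lemma tmap_comp_sum: "tmap gs \<circ> (\<Sum>i\<in>I. f i) = (\<Sum>i\<in>I. tmap gs \<circ> f i)"
  by (auto simp: fun_eq_iff sum_fun_apply tmap_sum)

context char0_vector_space
begin

lemma linear_endo_iff:
  "Vector_Spaces.linear scale scale f \<longleftrightarrow>
    (\<forall>x y. f (x + y) = f x + f y) \<and> (\<forall>c x. f (scale c x) = scale c (f x))"
  by (auto simp: Vector_Spaces.linear_iff vector_space_axioms)

lemma Hom_pow_iff: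
  "f \<in> Hom_pow n \<longleftrightarrow> (\<forall>x y. f (x + y) = f x + f y) \<and>
    (\<forall>c x. f (scale c x) = tscale c (f x)) \<and> (\<forall>x. f x \<in> tensor_power n)"
  by (auto simp: Hom_pow_def Vector_Spaces.linear_iff vector_space_axioms vector_space_tscale)

lemma tensor_power_zero: "0 \<in> tensor_power n"
  unfolding tensor_power_def
  by (rule module.span_zero) (simp add: module_iff_vector_space vector_space_tscale)

lemma tensor_power_add: "S \<in> tensor_power n \<Longrightarrow> T \<in> tensor_power n \<Longrightarrow> S + T \<in> tensor_power n"
  unfolding tensor_power_def
  by (rule module.span_add) (simp_all add: module_iff_vector_space vector_space_tscale)

lemma Hom_pow_zero: "0 \<in> Hom_pow n"
  by (auto simp: Hom_pow_iff tensor_power_zero tscale_def fun_eq_iff)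

lemma Hom_pow_add: "f \<in> Hom_pow n \<Longrightarrow> g \<in> Hom_pow n \<Longrightarrow> f + g \<in> Hom_pow n"
  by (auto simp: Hom_pow_iff tensor_power_add tscale_def fun_eq_iff algebra_simps)

lemma Hom_pow_sum: "(\<And>i. i \<in> I \<Longrightarrow> f i \<in> Hom_pow n) \<Longrightarrow> (\<Sum>i\<in>I. f i) \<in> Hom_pow n"
  by (induction I rule: infinite_finite_induct) (auto simp: Hom_pow_zero Hom_pow_add)

lemma Hom_pow_comp_zero: "f \<in> Hom_pow n \<Longrightarrow> f \<circ> 0 = 0"
proof -
  assume "f \<in> Hom_pow n"
  then have "f (scale 0 0) = tscale 0 (f 0)" by (simp only: Hom_pow_iff)
  then show ?thesis by (simp add: fun_eq_iff tscale_def)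
qed

lemma Hom_pow_uminus: "f \<in> Hom_pow n \<Longrightarrow> f (- x) = - f x"
proof -
  assume f: "f \<in> Hom_pow n"
  then have "f (x + - x) = f x + f (- x)" by (simp only: Hom_pow_iff)
  moreover have "f 0 = 0" using Hom_pow_comp_zero[OF f] by (metis comp_apply zero_fun_apply)
  ultimately show ?thesis by (simp add: eq_neg_iff_add_eq_0 add.commute)
qed

lemma Hom_pow_dual: "f \<in> Hom_pow n \<Longrightarrow> (\<lambda>x. f x ps) \<in> dual"
  by (auto simp: Hom_pow_iff dual_iff tscale_def)

lemma tmap_comp_Hom_pow:
  assumes "\<And>g. g \<in> set gs \<Longrightarrow> snd g \<in> Hom_pow (fst g)" and "f \<in> Hom_pow (length gs)"
  shows "tmap gs \<circ> f \<in> Hom_pow (sum_list (map fst gs))"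
  using assms(2) tmap_tensor_power[OF assms(1)]
  by (auto simp: Hom_pow_iff tmap_add) (auto simp: tmap_def tscale_def fun_eq_iff)

lemma pure_single: "pure [x] ps = (if length ps = 1 \<and> hd ps \<in> dual then hd ps x else 0)"
  by (cases ps) (auto simp: pure_Cons pure_Nil)

lemma pure_single_tensor_power: "pure [x] \<in> tensor_power 1"
  unfolding tensor_power_def
  by (rule module.span_base) (auto simp: module_iff_vector_space vector_space_tscale)

lemma emb_Hom_pow: "Vector_Spaces.linear scale scale f \<Longrightarrow> snd (emb f) \<in> Hom_pow (fst (emb f))"
  using pure_single_tensor_power
  by (auto simp: emb_def Hom_pow_iff linear_endo_iff fun_eq_iff pure_single tscale_def dual_iff)

lemma linear_id: "Vector_Spaces.linear scale scale id"
  by (simp add: linear_endo_iff)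

lemma fst_emb [simp]: "fst (emb f) = 1"
  by (simp add: emb_def)

lemma dual_pure_single: "Vector_Spaces.linear scale scale f \<Longrightarrow> (\<lambda>x. pure [f x] ps) \<in> dual"
  using Hom_pow_dual[OF emb_Hom_pow] by (simp add: emb_def)

text \<open>
  The tensor power of exponent one is \<open>C\<close> itself: \<open>x \<mapsto> pure [x]\<close> is linear, so its range contains
  the span of the elementary tensors, and it is injective because linear functionals separate points.
  This turns a 1-cochain into an honest endomorphism.
\<close>

lemma Hom_pow_1E:
  assumes "f \<in> Hom_pow 1"
  obtains \<phi> where "Vector_Spaces.linear scale scale \<phi>" "f = snd (emb \<phi>)"
proof -
  interpret T: vector_space "tscale :: 'k \<Rightarrow> (('a \<Rightarrow> 'k) list \<Rightarrow> 'k) \<Rightarrow> _" by (rule vector_space_tscale)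
  have lin: "pure [x + y] = pure [x] + pure [y]" "pure [scale c x] = tscale c (pure [x])" for x y c
    using emb_Hom_pow[OF linear_id] by (auto simp: emb_def Hom_pow_iff)
  have "\<exists>x. T = pure [x]" if "T \<in> tensor_power 1" for T
    using that[unfolded tensor_power_def]
  proof (induction rule: T.span_induct_alt)
    case base
    have "pure [0] = 0" using lin(2)[of 0 0] by (simp add: tscale_def zero_fun_def)
    then show ?case by (metis zero_fun_def)
  next
    case (step c a b)
    then obtain x y where "a = pure [x]" "b = pure [y]" by (auto simp: length_Suc_conv)
    then have "tscale c a + b = pure [scale c x + y]" by (simp only: lin)
    then show ?case by (auto simp only: plus_fun_def)
  qed
  then have "\<forall>x. \<exists>y. f x = pure [y]" using assms by (auto simp: Hom_pow_iff)
  then obtain \<phi> where \<phi>: "\<And>x. f x = pure [\<phi> x]" by metis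
  have inj: "x = y" if "pure [x] = pure [y]" for x y
  proof (rule ccontr)
    assume "x \<noteq> y"
    interpret K: vector_space "(*) :: 'k \<Rightarrow> 'k \<Rightarrow> 'k"
      by unfold_locales (auto simp: algebra_simps)
    interpret P: vector_space_pair scale "(*) :: 'k \<Rightarrow> 'k \<Rightarrow> 'k" ..
    have "independent {x - y}" using \<open>x \<noteq> y\<close> by simp
    from P.linear_independent_extend[OF this, of "\<lambda>_. 1"]
    obtain p where p: "p \<in> dual" "p (x - y) \<noteq> 0" by (auto simp: dual_def)
    have "pure [x] [p] = pure [y] [p]" using that by simp
    then have "p x = p y" using p(1) by (simp add: pure_single)
    moreover have "p (x - y) + p y = p x" using p(1) by (metis dual_iff diff_add_cancel)
    ultimately show False using p(2) by simp
  qed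
  have f: "f (x + y) = f x + f y" "f (scale c x) = tscale c (f x)" for x y c
    using assms by (auto simp: Hom_pow_iff)
  have "Vector_Spaces.linear scale scale \<phi>"
    unfolding linear_endo_iff
  proof (intro conjI allI)
    show "\<phi> (x + y) = \<phi> x + \<phi> y" for x y by (rule inj) (simp only: lin f flip: \<phi>)
    show "\<phi> (scale c x) = scale c (\<phi> x)" for c x by (rule inj) (simp only: lin f flip: \<phi>)
  qed
  then show ?thesis by (rule that) (auto simp: emb_def \<phi>)
qed

section \<open>Multilinearity of tensor products of maps\<close>

text \<open>
  A tensor is a multilinear form on functionals, because elementary tensors are.  As a tensor product of
  maps acts by pulling functionals back, this makes it multilinear in the maps.
\<close>

lemma tensor_slot_linear:
  assumes T: "T \<in> tensor_power n" and p: "p \<in> dual" and q: "q \<in> dual"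
  shows "T (us @ (\<lambda>x. p x + c * q x) # vs) = T (us @ p # vs) + c * T (us @ q # vs)"
proof -
  interpret T: vector_space "tscale :: 'k \<Rightarrow> (('a \<Rightarrow> 'k) list \<Rightarrow> 'k) \<Rightarrow> _" by (rule vector_space_tscale)
  have pq: "(\<lambda>x. p x + c * q x) \<in> dual"
    using p q by (auto simp: dual_iff algebra_simps)
  have pure: "pure xs (us @ (\<lambda>x. p x + c * q x) # vs) = pure xs (us @ p # vs) + c * pure xs (us @ q # vs)"
    for xs
  proof (induction us arbitrary: xs)
    case Nil
    then show ?case using p q pq by (cases xs) (auto simp: pure_Nil pure_Cons algebra_simps)
  next
    case (Cons u us)
    then show ?case by (cases xs) (auto simp: pure_Nil pure_Cons algebra_simps)
  qed
  show ?thesis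
    using T[unfolded tensor_power_def]
    by (induction rule: T.span_induct_alt) (auto simp: tscale_def pure algebra_simps)
qed

lemma tmap_slot_linear:
  assumes "T \<in> tensor_power n" and f: "f \<in> Hom_pow b" and g: "g \<in> Hom_pow b"
  shows "tmap (gs @ (b, \<lambda>x. f x + tscale c (g x)) # hs) T =
    tmap (gs @ (b, f) # hs) T + tscale c (tmap (gs @ (b, g) # hs) T)"
  using tensor_slot_linear[OF assms(1) Hom_pow_dual[OF f] Hom_pow_dual[OF g]]
  by (auto simp: tmap_def fun_eq_iff tscale_def pull_append)

lemma tmap_slot_add:
  assumes "T \<in> tensor_power n" "f \<in> Hom_pow b" "g \<in> Hom_pow b"
  shows "tmap (gs @ (b, f + g) # hs) T = tmap (gs @ (b, f) # hs) T + tmap (gs @ (b, g) # hs) T"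
  using tmap_slot_linear[OF assms, of gs 1 hs] by (simp add: tscale_def plus_fun_def)

lemma tmap_slot_zero:
  assumes "T \<in> tensor_power n"
  shows "tmap (gs @ (b, 0) # hs) T = 0"
  using tmap_slot_add[OF assms Hom_pow_zero Hom_pow_zero, of gs b hs] by simp

lemma tmap_slot_sum:
  assumes "T \<in> tensor_power n" "\<And>i. i \<in> I \<Longrightarrow> F i \<in> Hom_pow b"
  shows "tmap (gs @ (b, \<Sum>i\<in>I. F i) # hs) T = (\<Sum>i\<in>I. tmap (gs @ (b, F i) # hs) T)"
  using assms(2)
proof (induction I rule: infinite_finite_induct)
  case (insert i I)
  then have "tmap (gs @ (b, F i + (\<Sum>i\<in>I. F i)) # hs) T =
      tmap (gs @ (b, F i) # hs) T + tmap (gs @ (b, \<Sum>i\<in>I. F i) # hs) T"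
    by (intro tmap_slot_add[OF assms(1)] Hom_pow_sum) auto
  then show ?case using insert by (simp only: sum.insert not_False_eq_True insert_iff simp_thms)
qed (simp_all only: sum.infinite sum.empty tmap_slot_zero[OF assms(1)] not_False_eq_True)

lemma tmap_comp_slot_sum:
  assumes "Y \<in> Hom_pow n" "\<And>i. i \<in> I \<Longrightarrow> F i \<in> Hom_pow b"
  shows "tmap (gs @ (b, \<Sum>i\<in>I. F i) # hs) \<circ> Y = (\<Sum>i\<in>I. tmap (gs @ (b, F i) # hs) \<circ> Y)"
proof
  fix x
  have "Y x \<in> tensor_power n" using assms(1) by (simp add: Hom_pow_iff)
  then have "tmap (gs @ (b, \<Sum>i\<in>I. F i) # hs) (Y x) = (\<Sum>i\<in>I. tmap (gs @ (b, F i) # hs) (Y x))"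
    by (rule tmap_slot_sum) (rule assms(2))
  also have "\<dots> = (\<Sum>i\<in>I. (tmap (gs @ (b, F i) # hs) \<circ> Y) x)" by (simp only: comp_apply)
  also have "\<dots> = (\<Sum>i\<in>I. tmap (gs @ (b, F i) # hs) \<circ> Y) x" by (rule sum_fun_apply[symmetric])
  finally show "(tmap (gs @ (b, \<Sum>i\<in>I. F i) # hs) \<circ> Y) x = (\<Sum>i\<in>I. tmap (gs @ (b, F i) # hs) \<circ> Y) x"
    by (simp only: comp_apply)
qed

lemma tmap_comp_slot_zero: "Y \<in> Hom_pow n \<Longrightarrow> tmap (gs @ (b, 0) # hs) \<circ> Y = 0"
proof
  fix x
  assume "Y \<in> Hom_pow n"
  then have "Y x \<in> tensor_power n" by (simp add: Hom_pow_iff)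
  then show "(tmap (gs @ (b, 0) # hs) \<circ> Y) x = 0 x"
    by (simp only: comp_apply tmap_slot_zero zero_fun_apply)
qed

lemma emb_zero: "emb 0 = (1, 0)"
proof -
  have "p 0 = 0" if "p \<in> dual" for p
    using that scale_zero_left[of 0] unfolding dual_iff by (metis mult_zero_left)
  then show ?thesis by (auto simp: emb_def fun_eq_iff pure_single)
qed

lemma tmap_slot_uminus:
  assumes T: "T \<in> tensor_power n" and f: "f \<in> Hom_pow b"
  shows "tmap (gs @ (b, - f) # hs) T = - tmap (gs @ (b, f) # hs) T"
proof -
  have "- f = (\<lambda>x. 0 x + tscale (- 1) (f x))" by (auto simp: tscale_def fun_eq_iff)
  then have "tmap (gs @ (b, - f) # hs) T = tmap (gs @ (b, 0) # hs) T + tscale (- 1) (tmap (gs @ (b, f) # hs) T)"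
    by (simp only: tmap_slot_linear[OF T Hom_pow_zero f])
  then show ?thesis by (simp add: tmap_slot_zero[OF T]) (simp add: tscale_def fun_eq_iff)
qed

lemma two_factors_uminus:
  assumes \<phi>: "Vector_Spaces.linear scale scale \<phi>" and X: "X \<in> Hom_pow 2"
  shows "tmap [emb (- \<phi>), emb id] \<circ> X = - (tmap [emb \<phi>, emb id] \<circ> X)"
    and "tmap [emb id, emb (- \<phi>)] \<circ> X = - (tmap [emb id, emb \<phi>] \<circ> X)"
proof -
  have f: "snd (emb \<phi>) \<in> Hom_pow 1" using emb_Hom_pow[OF \<phi>] by simp
  have e: "emb \<phi> = (1, snd (emb \<phi>))" by (simp add: emb_def)
  have u: "emb (- \<phi>) = (1, - snd (emb \<phi>))"
    using Hom_pow_uminus[OF emb_Hom_pow[OF linear_id]] by (simp add: emb_def fun_eq_iff)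
  have T: "X x \<in> tensor_power 2" for x using X by (simp add: Hom_pow_iff)
  show "tmap [emb (- \<phi>), emb id] \<circ> X = - (tmap [emb \<phi>, emb id] \<circ> X)"
    unfolding u by (subst (2) e) (use tmap_slot_uminus[OF T f, of "[]"] in \<open>simp add: fun_eq_iff\<close>)
  show "tmap [emb id, emb (- \<phi>)] \<circ> X = - (tmap [emb id, emb \<phi>] \<circ> X)"
    unfolding u by (subst (2) e) (use tmap_slot_uminus[OF T f, of "[emb id]"] in \<open>simp add: fun_eq_iff\<close>)
qed

section \<open>Composition of tensor products of maps\<close>

lemma length_3E: "length ps = 3 \<Longrightarrow> (\<And>p q r. ps = [p, q, r] \<Longrightarrow> P) \<Longrightarrow> P"
  by (auto simp: numeral_3_eq_3 length_Suc_conv)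

text \<open>
  Functoriality of the tensor product, in the four shapes that are needed.  Both sides evaluate the
  same tensor at the same pulled-back functionals.  Elementary tensors vanish on functionals that are
  not linear, so wherever a functional passes through two single factors in turn, or through a block
  and then a single factor, the map that it meets first has to be linear.
\<close>

lemma tmap3_block_left:
  assumes "Vector_Spaces.linear scale scale c"
  shows "tmap [emb a, emb b, emb c] \<circ> (tmap [(2, X), emb id] \<circ> Y) =
    tmap [(2, tmap [emb a, emb b] \<circ> X), emb c] \<circ> Y"
proof (intro ext)
  fix x ps
  show "(tmap [emb a, emb b, emb c] \<circ> (tmap [(2, X), emb id] \<circ> Y)) x ps =
    (tmap [(2, tmap [emb a, emb b] \<circ> X), emb c] \<circ> Y) x ps"
  proof (cases "length ps = 3")
    case True
    then obtain p q r where "ps = [p, q, r]" by (rule length_3E)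
    then show ?thesis
      using dual_pure_single[OF assms, of "[r]"] by (simp add: tmap_def emb_def pure_single)
  qed (simp add: tmap_def emb_def)
qed

lemma tmap3_block_right:
  assumes "Vector_Spaces.linear scale scale a"
  shows "tmap [emb a, emb b, emb c] \<circ> (tmap [emb id, (2, X)] \<circ> Y) =
    tmap [emb a, (2, tmap [emb b, emb c] \<circ> X)] \<circ> Y"
proof (intro ext)
  fix x ps
  show "(tmap [emb a, emb b, emb c] \<circ> (tmap [emb id, (2, X)] \<circ> Y)) x ps =
    (tmap [emb a, (2, tmap [emb b, emb c] \<circ> X)] \<circ> Y) x ps"
  proof (cases "length ps = 3")
    case True
    then obtain p q r where "ps = [p, q, r]" by (rule length_3E)
    then show ?thesis
      using dual_pure_single[OF assms, of "[p]"] by (simp add: tmap_def emb_def pure_single)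
  qed (simp add: tmap_def emb_def)
qed

lemma tmap_block_comp_left:
  assumes "X \<in> Hom_pow 2"
  shows "tmap [(2, X \<circ> a), emb c] \<circ> Y = tmap [(2, X), emb id] \<circ> (tmap [emb a, emb c] \<circ> Y)"
proof (intro ext)
  fix x ps
  show "(tmap [(2, X \<circ> a), emb c] \<circ> Y) x ps = (tmap [(2, X), emb id] \<circ> (tmap [emb a, emb c] \<circ> Y)) x ps"
  proof (cases "length ps = 3")
    case True
    then obtain p q r where "ps = [p, q, r]" by (rule length_3E)
    then show ?thesis
      using dual_pure_single[OF linear_id, of "[r]"] Hom_pow_dual[OF assms, of "[p, q]"]
      by (simp add: tmap_def emb_def pure_single comp_def)
  qed (simp add: tmap_def emb_def)
qed

lemma tmap_block_comp_right:
  assumes "X \<in> Hom_pow 2"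
  shows "tmap [emb a, (2, X \<circ> c)] \<circ> Y = tmap [emb id, (2, X)] \<circ> (tmap [emb a, emb c] \<circ> Y)"
proof (intro ext)
  fix x ps
  show "(tmap [emb a, (2, X \<circ> c)] \<circ> Y) x ps = (tmap [emb id, (2, X)] \<circ> (tmap [emb a, emb c] \<circ> Y)) x ps"
  proof (cases "length ps = 3")
    case True
    then obtain p q r where "ps = [p, q, r]" by (rule length_3E)
    then show ?thesis
      using dual_pure_single[OF linear_id, of "[p]"] Hom_pow_dual[OF assms, of "[q, r]"]
      by (simp add: tmap_def emb_def pure_single comp_def)
  qed (simp add: tmap_def emb_def)
qed

lemma tmap_id:
  assumes "T \<in> tensor_power n"
  shows "tmap (replicate n (emb id)) T = T"
proof (rule tensor_power_unique[OF tmap_linear _ _ assms])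
  show "Vector_Spaces.linear tscale tscale (\<lambda>T. T :: ('k, 'a) tensor)"
    using vector_space_tscale by (rule vector_space.linear_ident)
  show "tmap (replicate n (emb id)) (pure xs) = pure xs" if "length xs = n" for xs
    using that
  proof (induction xs arbitrary: n)
    case (Cons x xs)
    have "snd (emb id) \<in> Hom_pow (fst (emb id))" by (rule emb_Hom_pow[OF linear_id])
    then have "tmap (emb id # replicate (length xs) (emb id)) (pure (x # xs)) = tprod 1 (pure [x]) (pure xs)"
      using Cons.IH[OF refl] by (simp add: emb_def tmap_Cons)
    also have "\<dots> = pure (x # xs)" using pure_append[of "[x]" xs] by simp
    finally show ?case by (simp only: length_Cons replicate_Suc flip: Cons.prems)
  qed (simp add: tmap_Nil)
qed

section \<open>Transport of a series along a formal map\<close>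

definition transport ::
    "(nat \<Rightarrow> 'a \<Rightarrow> 'a) \<Rightarrow> (nat \<Rightarrow> 'a \<Rightarrow> ('k, 'a) tensor) \<Rightarrow> nat \<Rightarrow> 'a \<Rightarrow> ('k, 'a) tensor"
  where "transport \<Phi> X n =
    (\<Sum>(i, j, k)\<in>{(i, j, k). i + j + k = n}. tmap [emb (\<Phi> i), emb (\<Phi> j)] \<circ> X k)"

text \<open>
  The coefficients of \<open>(X\<^sub>t \<otimes> id) Y\<^sub>t\<close> and \<open>(id \<otimes> X\<^sub>t) Y\<^sub>t\<close>, in terms of which the axioms of a
  deformation are stated, and the analogue of \<open>transport\<close> for series of maps into the third tensor
  power.
\<close>

definition left_conv ::
    "(nat \<Rightarrow> 'a \<Rightarrow> ('k, 'a) tensor) \<Rightarrow> (nat \<Rightarrow> 'a \<Rightarrow> ('k, 'a) tensor) \<Rightarrow> nat \<Rightarrow> 'a \<Rightarrow> ('k, 'a) tensor"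
  where "left_conv X Y n = (\<Sum>(i, j)\<in>{(i, j). i + j = n}. tmap [(2, X i), emb id] \<circ> Y j)"

definition right_conv ::
    "(nat \<Rightarrow> 'a \<Rightarrow> ('k, 'a) tensor) \<Rightarrow> (nat \<Rightarrow> 'a \<Rightarrow> ('k, 'a) tensor) \<Rightarrow> nat \<Rightarrow> 'a \<Rightarrow> ('k, 'a) tensor"
  where "right_conv X Y n = (\<Sum>(i, j)\<in>{(i, j). i + j = n}. tmap [emb id, (2, X i)] \<circ> Y j)"

definition transport3 ::
    "(nat \<Rightarrow> 'a \<Rightarrow> 'a) \<Rightarrow> (nat \<Rightarrow> 'a \<Rightarrow> ('k, 'a) tensor) \<Rightarrow> nat \<Rightarrow> 'a \<Rightarrow> ('k, 'a) tensor"
  where "transport3 \<Phi> X n = (\<Sum>(a, b, c, m)\<in>{(a, b, c, m). a + b + c + m = n}.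
    tmap [emb (\<Phi> a), emb (\<Phi> b), emb (\<Phi> c)] \<circ> X m)"

lemma two_factors_Hom_pow:
  assumes "Vector_Spaces.linear scale scale f" "Vector_Spaces.linear scale scale g" "X \<in> Hom_pow 2"
  shows "tmap [emb f, emb g] \<circ> X \<in> Hom_pow 2"
proof -
  have "snd h \<in> Hom_pow (fst h)" if "h \<in> set [emb f, emb g]" for h
    using that emb_Hom_pow assms(1,2) by auto
  then have "tmap [emb f, emb g] \<circ> X \<in> Hom_pow (sum_list (map fst [emb f, emb g]))"
    using assms(3) by (intro tmap_comp_Hom_pow) (auto simp: numeral_2_eq_2)
  then show ?thesis by (simp add: numeral_2_eq_2)
qed

lemma transport_Hom_pow:
  assumes "\<And>i. Vector_Spaces.linear scale scale (\<Phi> i)" "\<And>i. X i \<in> Hom_pow 2"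
  shows "transport \<Phi> X n \<in> Hom_pow 2"
  unfolding transport_def by (rule Hom_pow_sum) (use assms two_factors_Hom_pow in auto)

text \<open>
  The Leibniz rule behind the obstruction theory.  \<open>\<Phi>\<close> solves \<open>transport \<Phi> X = X\<^sub>0 \<Phi>\<^sub>t\<close> below degree
  \<open>n\<close> and is cut off there, so in degree \<open>n\<close> the defect is all of \<open>transport \<Phi> X n\<close>.  Absorb two
  factors \<open>\<Phi>\<^sub>t\<close> into \<open>X\<^sub>t\<close>: the defect can only meet \<open>\<Phi>\<^sub>0 = id\<close> and \<open>Y\<^sub>0\<close>, which gives the first
  summand; elsewhere \<open>X\<^sub>0\<close> can be pulled out, which leaves \<open>transport \<Phi> Y n\<close>.
\<close>

lemma transport3_left_conv:
  assumes lin: "\<And>i. Vector_Spaces.linear scale scale (\<Phi> i)"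
    and X: "\<And>i. X i \<in> Hom_pow 2" and Y: "\<And>i. Y i \<in> Hom_pow 2"
    and \<Phi>: "\<Phi> 0 = id" "\<Phi> n = 0"
    and solved: "\<forall>m<n. transport \<Phi> X m = X 0 \<circ> \<Phi> m"
  shows "transport3 \<Phi> (left_conv X Y) n =
    (tmap [(2, transport \<Phi> X n), emb id] \<circ> Y 0) + (tmap [(2, X 0), emb id] \<circ> transport \<Phi> Y n)"
proof -
  let ?G = "\<lambda>a b c i j. tmap [(2, tmap [emb (\<Phi> a), emb (\<Phi> b)] \<circ> X i), emb (\<Phi> c)] \<circ> Y j"
  let ?top = "tmap [(2, transport \<Phi> X n), emb id] \<circ> Y 0"
  have "transport3 \<Phi> (left_conv X Y) n =
      (\<Sum>(a, b, c, m)\<in>{(a, b, c, m). a + b + c + m = n}. \<Sum>(i, j)\<in>{(i, j). i + j = m}. ?G a b c i j)"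
    by (simp only: transport3_def left_conv_def tmap_comp_sum case_prod_beta' tmap3_block_left[OF lin])
  also have "\<dots> = (\<Sum>(m, c, j)\<in>{(m, c, j). m + c + j = n}.
      \<Sum>(a, b, i)\<in>{(a, b, i). a + b + i = m}. ?G a b c i j)"
    by (rule regroup_left)
  also have "\<dots> = (\<Sum>(m, c, j)\<in>{(m, c, j). m + c + j = n}.
      (tmap [(2, X 0), emb id] \<circ> (tmap [emb (\<Phi> m), emb (\<Phi> c)] \<circ> Y j)) +
      (if (m, c, j) = (n, 0, 0) then ?top else 0))"
  proof (rule sum.cong[OF refl])
    fix t assume "t \<in> {(m, c, j). m + c + j = n}"
    then obtain m c j where t: "t = (m, c, j)" and n: "n = m + c + j" by blast
    have "(\<Sum>(a, b, i)\<in>{(a, b, i). a + b + i = m}. ?G a b c i j) =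
        tmap [(2, transport \<Phi> X m), emb (\<Phi> c)] \<circ> Y j"
      unfolding transport_def
      using tmap_comp_slot_sum[OF Y, of "{(a, b, i). a + b + i = m}"
          "\<lambda>(a, b, i). tmap [emb (\<Phi> a), emb (\<Phi> b)] \<circ> X i" 2 "[]" "[emb (\<Phi> c)]" j]
        two_factors_Hom_pow[OF lin lin X]
      by (simp add: case_prod_beta)
    \<comment> \<open>For \<open>m = n\<close> the defect replaces \<open>X 0 \<circ> \<Phi> n\<close>, which is zero as \<open>\<Phi>\<close> is cut off.\<close>
    also have "\<dots> = (tmap [(2, X 0 \<circ> \<Phi> m), emb (\<Phi> c)] \<circ> Y j) + (if (m, c, j) = (n, 0, 0) then ?top else 0)"
    proof (cases "m = n")
      case True
      have "tmap [(2, X 0 \<circ> \<Phi> m), emb id] \<circ> Y 0 = 0"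
        using tmap_comp_slot_zero[OF Y, of "[]"]
        by (simp only: True \<Phi>(2) Hom_pow_comp_zero[OF X] append.simps)
      moreover have "c = 0" "j = 0" using True n by auto
      ultimately show ?thesis by (simp add: True \<Phi>(1))
    qed (use n in \<open>auto simp: solved\<close>)
    also have "tmap [(2, X 0 \<circ> \<Phi> m), emb (\<Phi> c)] \<circ> Y j =
        tmap [(2, X 0), emb id] \<circ> (tmap [emb (\<Phi> m), emb (\<Phi> c)] \<circ> Y j)"
      by (rule tmap_block_comp_left[OF X])
    finally show "(case t of (m, c, j) \<Rightarrow> (\<Sum>(a, b, i)\<in>{(a, b, i). a + b + i = m}. ?G a b c i j)) =
        (case t of (m, c, j) \<Rightarrow> (tmap [(2, X 0), emb id] \<circ> (tmap [emb (\<Phi> m), emb (\<Phi> c)] \<circ> Y j)) +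
        (if (m, c, j) = (n, 0, 0) then ?top else 0))"
      unfolding t prod.case .
  qed
  also have "\<dots> = (tmap [(2, X 0), emb id] \<circ> transport \<Phi> Y n) +
      (\<Sum>t\<in>{(m, c, j). m + c + j = n}. if t = (n, 0, 0) then ?top else 0)"
    by (simp only: transport_def tmap_comp_sum sum.distrib case_prod_beta' prod.collapse)
  also have "\<dots> = (tmap [(2, X 0), emb id] \<circ> transport \<Phi> Y n) + ?top"
    by (simp add: sum.delta')
  finally show ?thesis by (simp only: add.commute)
qed

lemma transport3_right_conv:
  assumes lin: "\<And>i. Vector_Spaces.linear scale scale (\<Phi> i)"
    and X: "\<And>i. X i \<in> Hom_pow 2" and Y: "\<And>i. Y i \<in> Hom_pow 2"
    and \<Phi>: "\<Phi> 0 = id" "\<Phi> n = 0"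
    and solved: "\<forall>m<n. transport \<Phi> X m = X 0 \<circ> \<Phi> m"
  shows "transport3 \<Phi> (right_conv X Y) n =
    (tmap [emb id, (2, transport \<Phi> X n)] \<circ> Y 0) + (tmap [emb id, (2, X 0)] \<circ> transport \<Phi> Y n)"
proof -
  let ?G = "\<lambda>a b c i j. tmap [emb (\<Phi> a), (2, tmap [emb (\<Phi> b), emb (\<Phi> c)] \<circ> X i)] \<circ> Y j"
  let ?top = "tmap [emb id, (2, transport \<Phi> X n)] \<circ> Y 0"
  have "transport3 \<Phi> (right_conv X Y) n =
      (\<Sum>(a, b, c, m)\<in>{(a, b, c, m). a + b + c + m = n}. \<Sum>(i, j)\<in>{(i, j). i + j = m}. ?G a b c i j)"
    by (simp only: transport3_def right_conv_def tmap_comp_sum case_prod_beta' tmap3_block_right[OF lin])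
  also have "\<dots> = (\<Sum>(a, m, j)\<in>{(a, m, j). a + m + j = n}.
      \<Sum>(b, c, i)\<in>{(b, c, i). b + c + i = m}. ?G a b c i j)"
    by (rule regroup_right)
  also have "\<dots> = (\<Sum>(a, m, j)\<in>{(a, m, j). a + m + j = n}.
      (tmap [emb id, (2, X 0)] \<circ> (tmap [emb (\<Phi> a), emb (\<Phi> m)] \<circ> Y j)) +
      (if (a, m, j) = (0, n, 0) then ?top else 0))"
  proof (rule sum.cong[OF refl])
    fix t assume "t \<in> {(a, m, j). a + m + j = n}"
    then obtain a m j where t: "t = (a, m, j)" and n: "n = a + m + j" by blast
    have "(\<Sum>(b, c, i)\<in>{(b, c, i). b + c + i = m}. ?G a b c i j) =
        tmap [emb (\<Phi> a), (2, transport \<Phi> X m)] \<circ> Y j"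
      unfolding transport_def
      using tmap_comp_slot_sum[OF Y, of "{(b, c, i). b + c + i = m}"
          "\<lambda>(b, c, i). tmap [emb (\<Phi> b), emb (\<Phi> c)] \<circ> X i" 2 "[emb (\<Phi> a)]" "[]" j]
        two_factors_Hom_pow[OF lin lin X]
      by (simp add: case_prod_beta)
    also have "\<dots> = (tmap [emb (\<Phi> a), (2, X 0 \<circ> \<Phi> m)] \<circ> Y j) + (if (a, m, j) = (0, n, 0) then ?top else 0)"
    proof (cases "m = n")
      case True
      have "tmap [emb id, (2, X 0 \<circ> \<Phi> m)] \<circ> Y 0 = 0"
        using tmap_comp_slot_zero[OF Y, of "[emb id]" 2 "[]"]
        by (simp only: True \<Phi>(2) Hom_pow_comp_zero[OF X] append.simps)
      moreover have "a = 0" "j = 0" using True n by auto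
      ultimately show ?thesis by (simp add: True \<Phi>(1))
    qed (use n in \<open>auto simp: solved\<close>)
    also have "tmap [emb (\<Phi> a), (2, X 0 \<circ> \<Phi> m)] \<circ> Y j =
        tmap [emb id, (2, X 0)] \<circ> (tmap [emb (\<Phi> a), emb (\<Phi> m)] \<circ> Y j)"
      by (rule tmap_block_comp_right[OF X])
    finally show "(case t of (a, m, j) \<Rightarrow> (\<Sum>(b, c, i)\<in>{(b, c, i). b + c + i = m}. ?G a b c i j)) =
        (case t of (a, m, j) \<Rightarrow> (tmap [emb id, (2, X 0)] \<circ> (tmap [emb (\<Phi> a), emb (\<Phi> m)] \<circ> Y j)) +
        (if (a, m, j) = (0, n, 0) then ?top else 0))"
      unfolding t prod.case .
  qed
  also have "\<dots> = (tmap [emb id, (2, X 0)] \<circ> transport \<Phi> Y n) +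
      (\<Sum>t\<in>{(a, m, j). a + m + j = n}. if t = (0, n, 0) then ?top else 0)"
    by (simp only: transport_def tmap_comp_sum sum.distrib case_prod_beta' prod.collapse)
  also have "\<dots> = (tmap [emb id, (2, X 0)] \<circ> transport \<Phi> Y n) + ?top"
    by (simp add: sum.delta')
  finally show ?thesis by (simp only: add.commute)
qed

text \<open>
  The new coefficient \<open>\<Phi>\<^sub>n\<close> enters degree \<open>n\<close> only once in each factor, next to \<open>\<Phi>\<^sub>0 = id\<close> and
  \<open>X\<^sub>0\<close>; the two occurrences do not interact because \<open>n > 0\<close>.
\<close>

lemma transport_add_correction:
  assumes X: "X 0 \<in> Hom_pow 2" and \<Phi>: "\<Phi> 0 = id" "\<Phi> n = 0" and n: "0 < n"
  shows "transport (\<Phi>(n := \<phi>)) X n =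
    transport \<Phi> X n + (tmap [emb \<phi>, emb id] \<circ> X 0) + (tmap [emb id, emb \<phi>] \<circ> X 0)"
proof -
  let ?l = "tmap [emb \<phi>, emb id] \<circ> X 0" and ?r = "tmap [emb id, emb \<phi>] \<circ> X 0"
  have zero: "tmap [emb 0, emb id] \<circ> X 0 = 0" "tmap [emb id, emb 0] \<circ> X 0 = 0"
    using tmap_comp_slot_zero[OF X, of "[]" 1 "[emb id]"] tmap_comp_slot_zero[OF X, of "[emb id]" 1 "[]"]
    by (simp_all add: emb_zero)
  have "transport (\<Phi>(n := \<phi>)) X n =
      (\<Sum>(i, j, k)\<in>{(i, j, k). i + j + k = n}. (tmap [emb (\<Phi> i), emb (\<Phi> j)] \<circ> X k) +
        (if (i, j, k) = (n, 0, 0) then ?l else 0) + (if (i, j, k) = (0, n, 0) then ?r else 0))"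
    unfolding transport_def
    by (rule sum.cong[OF refl]) (use n in \<open>auto simp: \<Phi> zero\<close>)
  also have "\<dots> = transport \<Phi> X n +
      (\<Sum>t\<in>{(i, j, k). i + j + k = n}. if t = (n, 0, 0) then ?l else 0) +
      (\<Sum>t\<in>{(i, j, k). i + j + k = n}. if t = (0, n, 0) then ?r else 0)"
    by (simp only: transport_def sum.distrib case_prod_beta' prod.collapse)
  finally show ?thesis by (simp add: sum.delta')
qed

lemma transport_add:
  "transport \<Phi> (\<lambda>i. X i + Y i) n = transport \<Phi> X n + transport \<Phi> Y n"
proof -
  have "tmap gs \<circ> (f + g) = (tmap gs \<circ> f) + (tmap gs \<circ> g)"
    for gs and f g :: "'a \<Rightarrow> ('k, 'a) tensor"
    by (rule ext) (simp only: comp_apply plus_fun_apply tmap_add)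
  then show ?thesis by (simp only: transport_def case_prod_beta' sum.distrib)
qed

lemma transport_cong:
  assumes "\<And>i. i \<le> n \<Longrightarrow> \<Phi> i = \<Psi> i"
  shows "transport \<Phi> X n = transport \<Psi> X n"
  unfolding transport_def by (rule sum.cong) (auto simp: assms)

end

section \<open>Cocycles and coboundaries in low degree\<close>

context dendriform_coalgebra
begin

lemma at_vec_R1:
  "at_vec 2 \<sigma> (R1 m i 2 r) = (if r = i then \<sigma> 1 else if r = i + 1 then \<sigma> 2 else \<sigma> 1 + \<sigma> 2)"
proof -
  have "{1..2} = {1, 2 :: nat}" by auto
  moreover consider "r = i" | "r = i + 1" | "\<not> (i \<le> r \<and> r \<le> i + 1)" by linarith
  ultimately show ?thesis
    by cases (auto simp: at_vec_def R1_def tscale_def fun_eq_iff)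
qed

text \<open>
  In degree one both structure maps see the same \<open>\<phi>\<close>, as \<open>C\<^sub>1\<close> has a single element; the formula is
  the coderivation defect of \<open>\<phi>\<close>, up to the sign fixed by the complex.
\<close>

lemma delta_1:
  assumes \<phi>: "\<sigma> 1 = snd (emb \<phi>)" and s: "s \<in> {1, 2}"
  shows "\<delta> 1 \<sigma> s = (tmap [emb id, emb \<phi>] \<circ> \<Delta> s) - (\<Delta> s \<circ> \<phi>) + (tmap [emb \<phi>, emb id] \<circ> \<Delta> s)"
proof
  fix x
  have v: "at_vec 1 \<sigma> (R1 2 i 1 s) = snd (emb \<phi>)" if "i \<in> {1, 2}" for i
    using that s by (auto simp: at_vec_def R1_def \<phi>[unfolded One_nat_def] tscale_def fun_eq_iff)
  have two: "\<Delta> (Suc (Suc 0)) = \<Delta> 2" by (simp add: numeral_2_eq_2)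
  have w: "at_vec 2 \<Delta> (R1 1 1 2 s) = \<Delta> s"
    using s by (auto simp: at_vec_R1 two)
  have r: "R0 2 2 1 s = s" "R0 2 1 1 s = s" "R0 1 1 2 s = 1"
    using s by (auto simp: R0_def)
  have h: "\<Delta> s \<in> Hom_pow 2" using s dl dr by (auto simp: \<Delta>_def)
  have "tmap [(2, \<Delta> s)] (pure [\<phi> x]) = \<Delta> s (\<phi> x)"
    using tensor_power_length[of "\<Delta> s (\<phi> x)" 2] h
    by (auto simp: tmap_Cons tmap_Nil tprod_def pure_Nil fun_eq_iff Hom_pow_iff not_less)
  moreover have "(1, snd (emb \<phi>)) = emb \<phi>" "snd (emb \<phi>) x = pure [\<phi> x]"
    by (simp_all add: emb_def)
  moreover have "\<delta> 1 \<sigma> s x = tmap [emb id, (1, at_vec 1 \<sigma> (R1 2 2 1 s))] (\<Delta> (R0 2 2 1 s) x) -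
      tmap [(2, at_vec 2 \<Delta> (R1 1 1 2 s))] (\<sigma> (R0 1 1 2 s) x) +
      tmap [(1, at_vec 1 \<sigma> (R1 2 1 1 s)), emb id] (\<Delta> (R0 2 1 1 s) x)"
    using s by (auto simp: \<delta>_def tscale_def fun_eq_iff)
  ultimately show "\<delta> 1 \<sigma> s x =
      ((tmap [emb id, emb \<phi>] \<circ> \<Delta> s) - (\<Delta> s \<circ> \<phi>) + (tmap [emb \<phi>, emb id] \<circ> \<Delta> s)) x"
    using v[of 1] v[of 2]
    by (simp only: r w \<phi> comp_apply plus_fun_apply minus_apply insert_iff simp_thms)
qed

text \<open>
  The three values of the coboundary of a 2-cochain are, up to sign, the derivatives of the three dendriform
  axioms in the direction \<open>(\<sigma> 1, \<sigma> 2)\<close>, which explains why the first-order part of a deformation is a cocycle.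
\<close>

lemma cocycle_2I:
  assumes \<sigma>: "\<sigma> \<in> cochains 2"
    and 1: "(tmap [(2, \<sigma> 1), emb id] \<circ> dl) + (tmap [(2, dl), emb id] \<circ> \<sigma> 1) =
      (tmap [emb id, (2, \<sigma> 1 + \<sigma> 2)] \<circ> dl) + (tmap [emb id, (2, dl + dr)] \<circ> \<sigma> 1)"
    and 2: "(tmap [(2, \<sigma> 2), emb id] \<circ> dl) + (tmap [(2, dr), emb id] \<circ> \<sigma> 1) =
      (tmap [emb id, (2, \<sigma> 1)] \<circ> dr) + (tmap [emb id, (2, dl)] \<circ> \<sigma> 2)"
    and 3: "(tmap [(2, \<sigma> 1 + \<sigma> 2), emb id] \<circ> dr) + (tmap [(2, dl + dr), emb id] \<circ> \<sigma> 2) =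
      (tmap [emb id, (2, \<sigma> 2)] \<circ> dr) + (tmap [emb id, (2, dr)] \<circ> \<sigma> 2)"
  shows "\<sigma> \<in> cocycles 2"
proof -
  have i: "{Suc 0..2} = {1, 2}" and two: "\<sigma> (Suc (Suc 0)) = \<sigma> 2"
    by (auto simp: numeral_2_eq_2)
  have "\<delta> 2 \<sigma> r x ps = 0" for r x ps
  proof -
    consider "r = 1" | "r = 2" | "r = 3" | "r \<notin> {1..2 + 1}" by fastforce
    then show ?thesis
    proof cases
      assume "r = 1"
      then show ?thesis
        using fun_cong[OF fun_cong[OF 1, of x], of ps]
        by (simp add: \<delta>_def i two at_vec_R1 R0_def \<Delta>_def tscale_def algebra_simps)
    next
      assume "r = 2"
      then show ?thesis
        using fun_cong[OF fun_cong[OF 2, of x], of ps]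
        by (simp add: \<delta>_def i two at_vec_R1 R0_def \<Delta>_def tscale_def algebra_simps)
    next
      assume "r = 3"
      then show ?thesis
        using fun_cong[OF fun_cong[OF 3, of x], of ps]
        by (simp add: \<delta>_def i two at_vec_R1 R0_def \<Delta>_def tscale_def algebra_simps)
    qed (simp add: \<delta>_def)
  qed
  then show ?thesis using \<sigma> by (simp add: cocycles_def fun_eq_iff)
qed

text \<open>
  The class of \<open>\<sigma>\<close> can only be the coset of the coboundaries; it contains \<open>\<sigma>\<close> once zero is known to
  be a coboundary.
\<close>

lemma cocycle_is_coboundary:
  assumes "cohomology 2 = {coboundaries 2}" and \<sigma>: "\<sigma> \<in> cocycles 2"
  shows "\<sigma> \<in> coboundaries 2"
proof -
  let ?R = "{(\<sigma>, \<tau>). \<sigma> \<in> cocycles 2 \<and> \<tau> \<in> cocycles 2 \<and> \<sigma> - \<tau> \<in> coboundaries 2}"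
  have c: "?R `` {\<tau>} = coboundaries 2" if "\<tau> \<in> cocycles 2" for \<tau>
    using quotientI[OF that, of ?R] assms(1) by (simp add: cohomology_def)
  have "\<delta> 1 0 s = 0" for s
  proof (cases "s \<in> {1, 2}")
    case True
    then have H: "\<Delta> s \<in> Hom_pow 2" using dl dr by (auto simp: \<Delta>_def)
    have "tmap [emb id, emb 0] \<circ> \<Delta> s = 0" "tmap [emb 0, emb id] \<circ> \<Delta> s = 0"
      using tmap_comp_slot_zero[OF H, of "[emb id]" 1 "[]"] tmap_comp_slot_zero[OF H, of "[]" 1 "[emb id]"]
      by (simp_all add: emb_zero)
    then show ?thesis
      using delta_1[of 0 0 s] True Hom_pow_comp_zero[OF H] by (simp add: emb_zero)
  next
    case False
    then have "s \<notin> {1..1 + 1}" by auto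
    then show ?thesis by (simp only: \<delta>_def if_True not_False_eq_True)
  qed
  then have "\<delta> 1 0 = 0" by (simp add: fun_eq_iff)
  moreover have "0 \<in> cochains 1" by (simp add: cochains_def Hom_pow_zero)
  ultimately have "0 \<in> coboundaries 2"
    by (simp add: coboundaries_def numeral_2_eq_2 image_iff) metis
  then have "\<sigma> \<in> ?R `` {\<sigma>}" using \<sigma> by simp
  then show ?thesis by (simp only: c[OF \<sigma>])
qed

section \<open>Killing the obstructions\<close>

text \<open>
  Transporting the three axioms and reading off degree \<open>n\<close> yields the premises of \<open>cocycle_2I\<close>.  The
  sum of the two structure maps, which occurs in the first and third axiom, satisfies the same equation
  below degree \<open>n\<close> by additivity of \<open>transport\<close>.
\<close>

lemma obstruction_is_cocycle:
  assumes def: "deformation L R"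
    and lin: "\<And>i. Vector_Spaces.linear scale scale (\<Phi> i)"
    and \<Phi>: "\<Phi> 0 = id" "\<Phi> n = 0"
    and L: "\<And>m. m < n \<Longrightarrow> transport \<Phi> L m = dl \<circ> \<Phi> m"
    and R: "\<And>m. m < n \<Longrightarrow> transport \<Phi> R m = dr \<circ> \<Phi> m"
  defines "\<sigma> \<equiv> \<lambda>r. if r = 1 then transport \<Phi> L n else if r = 2 then transport \<Phi> R n else 0"
  shows "\<sigma> \<in> cocycles 2"
proof (rule cocycle_2I)
  let ?S = "\<lambda>i. L i + R i"
  have H: "L i \<in> Hom_pow 2" "R i \<in> Hom_pow 2" "?S i \<in> Hom_pow 2" for i
    using def by (auto simp: deformation_def Hom_pow_add)
  have zero: "L 0 = dl" "R 0 = dr" using def by (auto simp: deformation_def)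
  have conv: "left_conv L L m = right_conv ?S L m" "left_conv R L m = right_conv L R m"
    "left_conv ?S R m = right_conv R R m" for m
    using def by (auto simp: deformation_def left_conv_def right_conv_def)
  have solved: "\<forall>m<n. transport \<Phi> L m = L 0 \<circ> \<Phi> m" "\<forall>m<n. transport \<Phi> R m = R 0 \<circ> \<Phi> m"
    using L R by (simp_all add: zero)
  then have S: "\<forall>m<n. transport \<Phi> ?S m = ?S 0 \<circ> \<Phi> m"
    by (simp add: transport_add fun_eq_iff)
  note left = transport3_left_conv[where \<Phi>=\<Phi>, OF lin H(1) H(1) \<Phi> solved(1)]
    transport3_left_conv[where \<Phi>=\<Phi>, OF lin H(2) H(1) \<Phi> solved(2)]
    transport3_left_conv[where \<Phi>=\<Phi>, OF lin H(3) H(2) \<Phi> S]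
  note right = transport3_right_conv[where \<Phi>=\<Phi>, OF lin H(3) H(1) \<Phi> S]
    transport3_right_conv[where \<Phi>=\<Phi>, OF lin H(1) H(2) \<Phi> solved(1)]
    transport3_right_conv[where \<Phi>=\<Phi>, OF lin H(2) H(2) \<Phi> solved(2)]
  have three: "transport3 \<Phi> (left_conv L L) n = transport3 \<Phi> (right_conv ?S L) n"
    "transport3 \<Phi> (left_conv R L) n = transport3 \<Phi> (right_conv L R) n"
    "transport3 \<Phi> (left_conv ?S R) n = transport3 \<Phi> (right_conv R R) n"
    by (simp_all only: transport3_def conv)
  note eqs = three[unfolded left right transport_add zero]
  have \<sigma>: "\<sigma> 1 = transport \<Phi> L n" "\<sigma> 2 = transport \<Phi> R n" by (simp_all add: \<sigma>_def)
  show "\<sigma> \<in> cochains 2"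
    using transport_Hom_pow[where \<Phi>=\<Phi>, OF lin H(1)] transport_Hom_pow[where \<Phi>=\<Phi>, OF lin H(2)]
    by (auto simp: cochains_def \<sigma>_def)
  show "(tmap [(2, \<sigma> 1), emb id] \<circ> dl) + (tmap [(2, dl), emb id] \<circ> \<sigma> 1) =
      (tmap [emb id, (2, \<sigma> 1 + \<sigma> 2)] \<circ> dl) + (tmap [emb id, (2, dl + dr)] \<circ> \<sigma> 1)"
    unfolding \<sigma> by (rule eqs(1))
  show "(tmap [(2, \<sigma> 2), emb id] \<circ> dl) + (tmap [(2, dr), emb id] \<circ> \<sigma> 1) =
      (tmap [emb id, (2, \<sigma> 1)] \<circ> dr) + (tmap [emb id, (2, dl)] \<circ> \<sigma> 2)"
    unfolding \<sigma> by (rule eqs(2))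
  show "(tmap [(2, \<sigma> 1 + \<sigma> 2), emb id] \<circ> dr) + (tmap [(2, dl + dr), emb id] \<circ> \<sigma> 2) =
      (tmap [emb id, (2, \<sigma> 2)] \<circ> dr) + (tmap [emb id, (2, dr)] \<circ> \<sigma> 2)"
    unfolding \<sigma> by (rule eqs(3))
qed

text \<open>
  The inductive step: the obstruction is the coboundary of some \<open>\<phi>\<close>, and \<open>- \<phi>\<close> is the next
  coefficient.
\<close>

lemma extend_isomorphism:
  assumes H2: "cohomology 2 = {coboundaries 2}" and def: "deformation L R"
    and lin: "\<And>m. m < n \<Longrightarrow> Vector_Spaces.linear scale scale (\<Phi> m)"
    and \<Phi>: "\<Phi> 0 = id" and n: "0 < n"
    and L: "\<And>m. m < n \<Longrightarrow> transport \<Phi> L m = dl \<circ> \<Phi> m"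
    and R: "\<And>m. m < n \<Longrightarrow> transport \<Phi> R m = dr \<circ> \<Phi> m"
  obtains \<phi> where "Vector_Spaces.linear scale scale \<phi>"
    "transport (\<Phi>(n := \<phi>)) L n = dl \<circ> \<phi>" "transport (\<Phi>(n := \<phi>)) R n = dr \<circ> \<phi>"
proof -
  have H: "L i \<in> Hom_pow 2" "R i \<in> Hom_pow 2" for i
    using def by (auto simp: deformation_def)
  have zero: "L 0 = dl" "R 0 = dr" using def by (auto simp: deformation_def)
  \<comment> \<open>Cutting \<open>\<Phi>\<close> off at \<open>n\<close> makes the coefficients of degree \<open>n\<close> of the transports the pure obstruction.\<close>
  define \<Psi> where "\<Psi> m = (if m < n then \<Phi> m else 0)" for m
  have \<Psi>: "\<Psi> 0 = id" "\<Psi> n = 0" using n \<Phi> by (auto simp: \<Psi>_def)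
  have "Vector_Spaces.linear scale scale (\<lambda>x. 0)" by (simp add: linear_endo_iff)
  then have lin': "Vector_Spaces.linear scale scale (\<Psi> i)" for i
    using lin by (simp add: \<Psi>_def zero_fun_def)
  have below: "transport \<Psi> L m = dl \<circ> \<Psi> m" "transport \<Psi> R m = dr \<circ> \<Psi> m" if "m < n" for m
    using that transport_cong[of m \<Psi> \<Phi>] L R by (simp_all add: \<Psi>_def)
  define \<sigma> where "\<sigma> r = (if r = 1 then transport \<Psi> L n else if r = 2 then transport \<Psi> R n else 0)" for r :: nat
  have "\<sigma> \<in> cocycles 2"
    unfolding \<sigma>_def[abs_def] by (rule obstruction_is_cocycle[OF def lin' \<Psi> below])
  then have "\<sigma> \<in> coboundaries 2" by (rule cocycle_is_coboundary[OF H2])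
  then obtain \<tau> where \<tau>: "\<tau> \<in> cochains 1" "\<sigma> = \<delta> 1 \<tau>"
    by (auto simp: coboundaries_def numeral_2_eq_2)
  then have "\<tau> 1 \<in> Hom_pow 1" by (auto simp: cochains_def)
  then obtain \<phi> where \<phi>: "Vector_Spaces.linear scale scale \<phi>" "\<tau> 1 = snd (emb \<phi>)" by (rule Hom_pow_1E)
  have "transport \<Psi> L n = (tmap [emb id, emb \<phi>] \<circ> dl) - (dl \<circ> \<phi>) + (tmap [emb \<phi>, emb id] \<circ> dl)"
    "transport \<Psi> R n = (tmap [emb id, emb \<phi>] \<circ> dr) - (dr \<circ> \<phi>) + (tmap [emb \<phi>, emb id] \<circ> dr)"
    using delta_1[of \<tau> \<phi> 1, OF \<phi>(2)] delta_1[of \<tau> \<phi> 2, OF \<phi>(2)]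
    unfolding \<tau>(2)[symmetric] by (simp_all add: \<sigma>_def \<Delta>_def)
  moreover have "X \<circ> (- \<phi>) = - (X \<circ> \<phi>)" if "X \<in> Hom_pow 2" for X
    using Hom_pow_uminus[OF that] by (simp add: fun_eq_iff)
  moreover have upd: "transport (\<Phi>(n := - \<phi>)) X n = transport (\<Psi>(n := - \<phi>)) X n" for X
    by (rule transport_cong) (auto simp: \<Psi>_def)
  ultimately have "transport (\<Phi>(n := - \<phi>)) L n = dl \<circ> (- \<phi>)"
    "transport (\<Phi>(n := - \<phi>)) R n = dr \<circ> (- \<phi>)"
    using transport_add_correction[OF H(1) \<Psi> n, of "- \<phi>"] transport_add_correction[OF H(2) \<Psi> n, of "- \<phi>"]
      two_factors_uminus[OF \<phi>(1)] dl dr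
    by (simp_all add: zero)
  moreover have "Vector_Spaces.linear scale scale (- \<phi>)"
    using \<phi>(1) by (simp add: linear_endo_iff)
  ultimately show ?thesis using that by blast
qed

theorem deformation_trivial:
  assumes H2: "cohomology 2 = {coboundaries 2}" and def: "deformation L R"
  shows "equivalent L R (constant_series dl) (constant_series dr)"
proof -
  \<comment> \<open>\<open>P \<Phi> n \<phi>\<close>: the map \<open>\<phi>\<close> is a valid coefficient of degree \<open>n\<close> after \<open>\<Phi> 0, \<dots>, \<Phi> (n - 1)\<close>.  The
    update by \<open>\<phi>\<close> makes \<open>P\<close> depend on \<open>\<Phi>\<close> below \<open>n\<close> only, as recursive choice requires.\<close>
  define P where "P \<Phi> n \<phi> \<longleftrightarrow> Vector_Spaces.linear scale scale \<phi> \<and> (n = 0 \<longrightarrow> \<phi> = id) \<and>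
      transport (\<Phi>(n := \<phi>)) L n = dl \<circ> \<phi> \<and> transport (\<Phi>(n := \<phi>)) R n = dr \<circ> \<phi>"
    for \<Phi> and n :: nat and \<phi>
  have "\<exists>\<Phi>. \<forall>n. P \<Phi> n (\<Phi> n)"
  proof (rule dependent_wf_choice[OF wf_less])
    fix \<Phi> \<Psi> :: "nat \<Rightarrow> 'a \<Rightarrow> 'a" and n :: nat and \<phi>
    assume "\<And>m. (m, n) \<in> {(x, y). x < y} \<Longrightarrow> \<Phi> m = \<Psi> m"
    then have "transport (\<Phi>(n := \<phi>)) X n = transport (\<Psi>(n := \<phi>)) X n" for X
      by (intro transport_cong) auto
    then show "P \<Phi> n \<phi> = P \<Psi> n \<phi>" by (simp add: P_def)
  next
    fix n :: nat and \<Phi> assume "\<And>m. (m, n) \<in> {(x, y). x < y} \<Longrightarrow> P \<Phi> m (\<Phi> m)"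
    then have below: "Vector_Spaces.linear scale scale (\<Phi> m)" "m = 0 \<Longrightarrow> \<Phi> m = id"
      "transport \<Phi> L m = dl \<circ> \<Phi> m" "transport \<Phi> R m = dr \<circ> \<Phi> m" if "m < n" for m
      using that by (auto simp: P_def)
    show "\<exists>\<phi>. P \<Phi> n \<phi>"
    proof (cases "n = 0")
      case True
      have "{(i, j, k). i + j + k = (0::nat)} = {(0, 0, 0)}" by auto
      then have "transport (\<Phi>(0 := id)) X 0 = X 0" if "X 0 \<in> Hom_pow 2" for X
        using that tmap_id[of _ 2] by (auto simp: transport_def fun_eq_iff Hom_pow_iff numeral_2_eq_2)
      moreover have "L 0 = dl" "R 0 = dr" using def by (auto simp: deformation_def)
      ultimately have "P \<Phi> n id" by (simp add: P_def True linear_id dl dr)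
      then show ?thesis by blast
    next
      case False
      then obtain \<phi> where "Vector_Spaces.linear scale scale \<phi>"
        "transport (\<Phi>(n := \<phi>)) L n = dl \<circ> \<phi>" "transport (\<Phi>(n := \<phi>)) R n = dr \<circ> \<phi>"
        using extend_isomorphism[OF H2 def, of n \<Phi>] below by blast
      then show ?thesis using False by (auto simp: P_def)
    qed
  qed
  then obtain \<Phi> where \<Phi>: "\<And>n. P \<Phi> n (\<Phi> n)" by blast
  have const: "(\<Sum>(i, j)\<in>{(i, j). i + j = n}. constant_series d i \<circ> \<Phi> j) = d \<circ> \<Phi> n" for d n
  proof -
    have "(\<Sum>(i, j)\<in>{(i, j). i + j = n}. constant_series d i \<circ> \<Phi> j) =
        (\<Sum>t\<in>{(i, j). i + j = n}. if t = (0, n) then d \<circ> \<Phi> n else 0)"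
      by (rule sum.cong[OF refl]) (auto simp: constant_series_def fun_eq_iff split: if_splits)
    then show ?thesis by (simp add: sum.delta')
  qed
  show ?thesis
    unfolding equivalent_def
    by (rule exI[of _ \<Phi>]) (use \<Phi> in \<open>auto simp: P_def const transport_def\<close>)
qed

end

theorem theorem4p7:
  fixes scale :: "'k::field_char_0 \<Rightarrow> 'a::ab_group_add \<Rightarrow> 'a"
    and dl dr :: "'a \<Rightarrow> ('k, 'a) tensor"
    and L R :: "nat \<Rightarrow> 'a \<Rightarrow> ('k, 'a) tensor"
  assumes "dendriform_coalgebra scale dl dr"
    and "dendriform_coalgebra.cohomology scale dl dr 2
           = {dendriform_coalgebra.coboundaries scale dl dr 2}"
    and "dendriform_coalgebra.deformation scale dl dr L R"
  shows "dendriform_coalgebra.equivalent scale L R (constant_series dl) (constant_series dr)"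
  using assms by (rule dendriform_coalgebra.deformation_trivial)

end
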